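(* Let $G$ be an open subgroup of a ramified Cartan subgroup $C$ of $\mathrm{GL}_2(\mathbb{Z}_\ell)$ and let $n_0$ be the level of $G$. Then for all integers $a,b\geq0$ and all $n\geq n_0$, the number of matrices in $\mathcal{M}_{a,b}(n+1)$ that are congruent modulo $\ell^n$ to a given $M\in\mathcal{M}_{a,b}(n)$ does not depend on the choice of $M\in\mathcal{M}_{a,b}(n)$.
   Context: Let $\ell$ be a prime. A quadratic ring over $\mathbb{Z}_\ell$ is a subring $R$ (containing $1$) of a reduced $\mathbb{Q}_\ell$-algebra $F$ of degree $2$ (so $F$ is a quadratic field extension of $\mathbb{Q}_\ell$ or $F=\mathbb{Q}_\ell^2$) such that $R$ is a finitely generated $\mathbb{Z}_\ell$-module and $\mathbb{Q}_\ell R=F$; $\mathcal{O}_F$ denotes the maximal order of $F$. The Cartan subgroup associated with $R$ is $R^\times$ embedded in $\mathrm{GL}_2(\mathbb{Z}_\ell)$ via left multiplication on $R$ in a $\mathbb{Z}_\ell$-basis. It is ramified unless $\ell\nmid[\mathcal{O}_F:R]$ and $F$ is $\mathbb{Q}_\ell^2$ or the unramified quadratic field extension of $\mathbb{Q}_\ell$. For $X\subseteq\mathrm{GL}_2(\mathbb{Z}_\ell)$, $X(n)$ is its image in $\mathrm{GL}_2(\mathbb{Z}/\ell^n\mathbb{Z})$. The level $n_0$ of an open subgroup $G$ of $C$ is the smallest positive integer $n$ with $[C(n):G(n)]=[C:G]$. Identify $M\in\mathrm{GL}_2(\mathbb{Z}_\ell)$ with an automorphism of $\varinjlim_n(\mathbb{Z}/\ell^n\mathbb{Z})^2$;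 $\mathcal{M}_{a,b}=\{M\in G:\ \ker(M-I)\cong\mathbb{Z}/\ell^a\mathbb{Z}\times\mathbb{Z}/\ell^{a+b}\mathbb{Z}\}$ and $\mathcal{M}_{a,b}(n)$ is its image in $G(n)$. *)

theory Defs
  imports Complex_Main "HOL-Computational_Algebra.Primes" "HOL-Algebra.Elementary_Groups"
begin

section \<open>2x2 integer matrices, row-major: (a,b,c,d) = [[a,b],[c,d]]\<close>

type_synonym mat2 = "int \<times> int \<times> int \<times> int"

definition red :: "int \<Rightarrow> mat2 \<Rightarrow> mat2" where
  "red k M = (case M of (a,b,c,d) \<Rightarrow> (a mod k, b mod k, c mod k, d mod k))"

definition mmul :: "mat2 \<Rightarrow> mat2 \<Rightarrow> mat2" where
  "mmul M N = (case M of (a,b,c,d) \<Rightarrow> (case N of (e,f,g,h) \<Rightarrow>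
      (a*e + b*g, a*f + b*h, c*e + d*g, c*f + d*h)))"

definition mdet :: "mat2 \<Rightarrow> int" where
  "mdet M = (case M of (a,b,c,d) \<Rightarrow> a*d - b*c)"

definition mI :: mat2 where "mI = (1,0,0,1)"

text \<open>An element of Z_l is the sequence of its reductions modulo l^n (canonical
  representatives in [0, l^n)).  A matrix in M_2(Z_l) is the sequence of its
  reductions modulo l^n; so the image X(n) of a matrix X is just X n.\<close>

definition Zl :: "nat \<Rightarrow> (nat \<Rightarrow> int) set" where
  "Zl l = {x. \<forall>n. x n = x n mod (int l ^ n) \<and> x (Suc n) mod (int l ^ n) = x n}"

definition Matl :: "nat \<Rightarrow> (nat \<Rightarrow> mat2) set" where
  "Matl l = {M. \<forall>n. M n = red (int l ^ n) (M n) \<and> red (int l ^ n) (M (Suc n)) = M n}"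

definition GL2 :: "nat \<Rightarrow> (nat \<Rightarrow> mat2) set" where
  "GL2 l = {M \<in> Matl l. \<not> int l dvd mdet (M 1)}"

definition lmul :: "nat \<Rightarrow> (nat \<Rightarrow> mat2) \<Rightarrow> (nat \<Rightarrow> mat2) \<Rightarrow> (nat \<Rightarrow> mat2)" where
  "lmul l M N = (\<lambda>n. red (int l ^ n) (mmul (M n) (N n)))"

definition lI :: "nat \<Rightarrow> nat \<Rightarrow> mat2" where
  "lI l = (\<lambda>n. red (int l ^ n) mI)"

text \<open>Every quadratic ring over Z_l has a Z_l-basis (1, w) with w^2 = t w - d,
  t, d in Z_l, and Q_l R is reduced iff t^2 - 4d is nonzero.  Left multiplication
  by x + y w in the basis (1,w) has matrix [[x, -d y],[y, x + t y]]; it lies in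
  R^x iff its determinant is a unit.\<close>

definition quadratic_ring_data :: "nat \<Rightarrow> (nat \<Rightarrow> int) \<Rightarrow> (nat \<Rightarrow> int) \<Rightarrow> bool" where
  "quadratic_ring_data l t d \<longleftrightarrow> t \<in> Zl l \<and> d \<in> Zl l \<and>
     (\<exists>n. (t n ^ 2 - 4 * d n) mod (int l ^ n) \<noteq> 0)"

definition cartan_std :: "nat \<Rightarrow> (nat \<Rightarrow> int) \<Rightarrow> (nat \<Rightarrow> int) \<Rightarrow> (nat \<Rightarrow> mat2) set" where
  "cartan_std l t d = {M \<in> GL2 l. \<exists>x\<in>Zl l. \<exists>y\<in>Zl l.
      \<forall>n. M n = red (int l ^ n) (x n, - d n * y n, y n, x n + t n * y n)}"

text \<open>The Cartan subgroup in an arbitrary Z_l-basis of R: the conjugate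
  P C_std P^{-1} for the base-change matrix P in GL_2(Z_l).\<close>

definition cartan :: "nat \<Rightarrow> (nat \<Rightarrow> int) \<Rightarrow> (nat \<Rightarrow> int) \<Rightarrow> (nat \<Rightarrow> mat2) \<Rightarrow> (nat \<Rightarrow> mat2) set" where
  "cartan l t d P = {M \<in> GL2 l. \<exists>X\<in>cartan_std l t d. lmul l P X = lmul l M P}"

text \<open>Ramified: the discriminant t^2 - 4d of R is not a unit of Z_l
  (equivalently l | [O_F : R] or F is a ramified quadratic field).\<close>

definition ramified :: "nat \<Rightarrow> (nat \<Rightarrow> int) \<Rightarrow> (nat \<Rightarrow> int) \<Rightarrow> bool" where
  "ramified l t d \<longleftrightarrow> int l dvd (t 1 ^ 2 - 4 * d 1)"

definition open_subgroup :: "nat \<Rightarrow> (nat \<Rightarrow> mat2) set \<Rightarrow> (nat \<Rightarrow> mat2) set \<Rightarrow> bool" where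
  "open_subgroup l G C \<longleftrightarrow> G \<subseteq> C \<and> lI l \<in> G \<and>
     (\<forall>M\<in>G. \<forall>N\<in>G. lmul l M N \<in> G) \<and>
     (\<forall>M\<in>G. \<exists>N\<in>G. lmul l M N = lI l) \<and>
     (\<exists>m. \<forall>M\<in>C. M m = lI l m \<longrightarrow> M \<in> G)"

definition lvl_img :: "nat \<Rightarrow> (nat \<Rightarrow> mat2) set \<Rightarrow> mat2 set" where
  "lvl_img n X = (\<lambda>M. M n) ` X"

definition index_l :: "nat \<Rightarrow> (nat \<Rightarrow> mat2) set \<Rightarrow> (nat \<Rightarrow> mat2) set \<Rightarrow> nat" where
  "index_l l C G = card {(lmul l M) ` G | M. M \<in> C}"

definition index_n :: "nat \<Rightarrow> nat \<Rightarrow> (nat \<Rightarrow> mat2) set \<Rightarrow> (nat \<Rightarrow> mat2) set \<Rightarrow> nat" where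
  "index_n l n C G = card {(\<lambda>g. red (int l ^ n) (mmul A g)) ` lvl_img n G | A. A \<in> lvl_img n C}"

definition level :: "nat \<Rightarrow> (nat \<Rightarrow> mat2) set \<Rightarrow> (nat \<Rightarrow> mat2) set \<Rightarrow> nat" where
  "level l C G = (LEAST n. 0 < n \<and> index_n l n C G = index_l l C G)"

section \<open>The group (Q_l/Z_l)^2 = direct limit of (Z/l^n)^2 and the sets M_{a,b}\<close>

definition QZl :: "nat \<Rightarrow> rat set" where
  "QZl l = {q. 0 \<le> q \<and> q < 1 \<and> (\<exists>m. of_nat l ^ m * q \<in> \<int>)}"

definition QZ2 :: "nat \<Rightarrow> (rat \<times> rat) monoid" where
  "QZ2 l = \<lparr>carrier = QZl l \<times> QZl l,
            mult = (\<lambda>v w. (frac (fst v + fst w), frac (snd v + snd w))),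
            one = (0, 0)\<rparr>"

definition act :: "nat \<Rightarrow> (nat \<Rightarrow> mat2) \<Rightarrow> rat \<times> rat \<Rightarrow> rat \<times> rat" where
  "act l M v = (let m = (LEAST m. of_nat l ^ m * fst v \<in> \<int> \<and> of_nat l ^ m * snd v \<in> \<int>);
                    u = \<lfloor>of_nat l ^ m * fst v\<rfloor>; w = \<lfloor>of_nat l ^ m * snd v\<rfloor> in
     (case M m of (a,b,c,d) \<Rightarrow>
        (frac (of_int (a*u + b*w) / of_nat l ^ m), frac (of_int (c*u + d*w) / of_nat l ^ m))))"

definition fixker :: "nat \<Rightarrow> (nat \<Rightarrow> mat2) \<Rightarrow> (rat \<times> rat) set" where
  "fixker l M = {v \<in> carrier (QZ2 l). act l M v = v}"

definition Mab :: "nat \<Rightarrow> (nat \<Rightarrow> mat2) set \<Rightarrow> nat \<Rightarrow> nat \<Rightarrow> (nat \<Rightarrow> mat2) set" where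
  "Mab l G a b = {M \<in> G. (QZ2 l)\<lparr>carrier := fixker l M\<rparr> \<cong>
       DirProd (integer_mod_group (l ^ a)) (integer_mod_group (l ^ (a + b)))}"

definition Mab_n :: "nat \<Rightarrow> (nat \<Rightarrow> mat2) set \<Rightarrow> nat \<Rightarrow> nat \<Rightarrow> nat \<Rightarrow> mat2 set" where
  "Mab_n l G a b n = lvl_img n (Mab l G a b)"

end

theory Submission
  imports Defs
begin

text \<open>
  Write the quadratic ring as \<open>{x + y w}\<close> with norm form
  \<open>F(x, y) = x^2 + T x y + D y^2\<close>.  A matrix \<open>M\<close> of the Cartan subgroup lies in \<open>M_{a,b}\<close>
  iff \<open>M = 1 + l^a z\<close> with \<open>z\<close> primitive and \<open>F(z)\<close> of exact valuation \<open>b\<close> (Smith normal form),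
  and from the level on membership in \<open>G\<close> depends only on the class modulo \<open>l^n\<close>.  For \<open>n \<le> a\<close> all
  of \<open>M_{a,b}(n)\<close> is the identity; otherwise put \<open>m = n - a\<close> and compare the lifts modulo
  \<open>l^(m+1)\<close> of two such elements \<open>z1, z2\<close> given modulo \<open>l^m\<close>.

  If \<open>b > 0\<close> then the \<open>w\<close>-coordinates are units, and multiplication by a unit makes them equal, to \<open>y\<close> say.
  Then \<open>F(z1) - F(z2) = (x1 - x2) (x1 + x2 + T y)\<close> is divisible by \<open>l^b\<close>, so
  after applying the norm-preserving involution \<open>x \<mapsto> - x - T y\<close> if necessary,
  \<open>z1\<close> and \<open>z2\<close> agree modulo \<open>l^j\<close> where \<open>j\<close> is \<open>b/2\<close> rounded up.  If \<open>2 m \<le> b\<close> they are in the same class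
  modulo \<open>l^m\<close>.  If \<open>2 m > b\<close>, choose a unit \<open>c\<close> with \<open>c F(z1) \<equiv> F(z2)\<close> modulo \<open>l^(b+1)\<close>; the affine map
  \<open>z \<mapsto> z2 + c (z - z1)\<close> multiplies \<open>F\<close> by \<open>c\<close> modulo \<open>l^(b+1)\<close> on the class of \<open>z1\<close>, hence identifies the lifts.
\<close>

section \<open>Counting classes, and divisibility by prime powers\<close>

text \<open>A map \<open>h\<close> of representatives need not descend to the classes cut out by
  \<open>r\<close>. If it reflects equality of classes, choosing one representative per class
  already gives an injection.\<close>

lemma card_image_le_by_lifting:
  assumes "finite (r ` B)" and "h ` A \<subseteq> B"
    and "\<And>x y. x \<in> A \<Longrightarrow> y \<in> A \<Longrightarrow> r (h x) = r (h y) \<Longrightarrow> r x = r y"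
  shows "card (r ` A) \<le> card (r ` B)"
proof (rule card_inj_on_le)
  let ?g = "\<lambda>e. r (h (inv_into A r e))"
  show "inj_on ?g (r ` A)"
  proof (rule inj_onI)
    fix e e' assume e: "e \<in> r ` A" "e' \<in> r ` A" "?g e = ?g e'"
    then have "r (inv_into A r e) = r (inv_into A r e')"
      using assms(3) inv_into_into by metis
    then show "e = e'" using e by (simp add: f_inv_into_f)
  qed
  show "?g ` r ` A \<subseteq> r ` B"
    using assms(2) by (auto intro!: imageI intro: inv_into_into)
qed (use assms in simp)

text \<open>The valuations of \<open>u\<close> and \<open>v\<close> add up to at least
  \<open>b\<close>, so one of them is at least \<open>b / 2\<close> rounded up, which is the bound
  that \<open>2 * j \<le> Suc b\<close> puts on \<open>j\<close>.\<close>

lemma prime_power_dvd_mult_half: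
  fixes p u v :: int
  assumes "prime p" "p ^ b dvd u * v" "2 * j \<le> Suc b"
  shows "p ^ j dvd u \<or> p ^ j dvd v"
proof (cases "u = 0 \<or> v = 0")
  case False
  have "b \<le> multiplicity p u + multiplicity p v"
    using assms False
    by (metis mult_eq_0_iff not_prime_unit power_dvd_iff_le_multiplicity prime_elem_multiplicity_mult_distrib
        prime_imp_prime_elem)
  then have "j \<le> multiplicity p u \<or> j \<le> multiplicity p v" using assms(3) by linarith
  then show ?thesis by (auto intro: multiplicity_dvd')
qed auto

lemma prime_power_dvd_unit_mult_iff:
  fixes p c x :: int
  assumes "prime p" "\<not> p dvd c"
  shows "p ^ k dvd c * x \<longleftrightarrow> p ^ k dvd x"
  using prime_power_dvd_multD[of p k c x] assms by (cases "k = 0") auto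

lemma unit_mod_prime_power:
  fixes p c :: int
  assumes "prime p" "\<not> p dvd c"
  obtains c' where "p ^ k dvd c * c' - 1"
proof -
  have "coprime c (p ^ k)"
    using assms by (metis coprime_commute coprime_power_right_iff prime_imp_coprime)
  then obtain c' v where "c' * c + v * p ^ k = 1"
    using bezout_int[of c "p ^ k"] by (auto simp: coprime_iff_gcd_eq_1)
  then have "c * c' - 1 = p ^ k * (- v)" by (simp add: algebra_simps)
  then show ?thesis using that by (metis dvd_triv_left)
qed

definition exact_val :: "int \<Rightarrow> nat \<Rightarrow> int \<Rightarrow> bool" where
  "exact_val p b x \<longleftrightarrow> p ^ b dvd x \<and> \<not> p ^ Suc b dvd x"

lemma exact_val_cong:
  assumes "p ^ Suc b dvd x - y"
  shows "exact_val p b x \<longleftrightarrow> exact_val p b y"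
proof -
  have "p ^ b dvd x - y" using assms by (meson dvd_trans le_SucI le_refl le_imp_power_dvd)
  then show ?thesis using assms unfolding exact_val_def
    by (metis dvd_add_right_iff diff_add_cancel)
qed

lemma exact_val_unit_mult:
  assumes "prime p" "\<not> p dvd c"
  shows "exact_val p b (c * x) \<longleftrightarrow> exact_val p b x"
  unfolding exact_val_def using prime_power_dvd_unit_mult_iff[OF assms] by blast

text \<open>The multiplier is the quotient of the prime-to-\<open>p\<close> parts. Knowing it modulo
  \<open>p\<close> is enough, because the common factor \<open>p ^ b\<close> supplies the rest of
  the modulus.\<close>

lemma exact_val_proportional:
  assumes "prime p" "exact_val p b x" "exact_val p b y"
  obtains c where "\<not> p dvd c" "p ^ Suc b dvd c * x - y"
proof -
  obtain x' y' where x': "x = p ^ b * x'" and y': "y = p ^ b * y'"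
    using assms unfolding exact_val_def by (auto elim!: dvdE)
  have nz: "p ^ b \<noteq> 0" using assms(1) by auto
  have ux: "\<not> p dvd x'" and uy: "\<not> p dvd y'"
    using assms nz unfolding exact_val_def x' y' by (auto simp: mult.commute)
  obtain c' where c': "p ^ 1 dvd x' * c' - 1" using unit_mod_prime_power[OF assms(1) ux] .
  have 1: "p dvd c' * y' * x' - y'"
    using dvd_mult[OF c', of y'] by (simp add: algebra_simps)
  have "p ^ Suc b dvd (c' * y') * x - y"
    using mult_dvd_mono[OF dvd_refl 1, of "p ^ b"] unfolding x' y'
    by (simp add: algebra_simps)
  moreover have "\<not> p dvd c' * y'"
    using 1 uy by (metis dvd_diff_right_iff dvd_mult2)
  ultimately show ?thesis using that by blast
qed

section \<open>Lifts of primitive vectors with prescribed norm valuation\<close>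

definition nform :: "int \<Rightarrow> int \<Rightarrow> int \<times> int \<Rightarrow> int" where
  "nform T D z = fst z ^ 2 + T * fst z * snd z + D * snd z ^ 2"

definition prim_val :: "int \<Rightarrow> int \<Rightarrow> int \<Rightarrow> nat \<Rightarrow> (int \<times> int) set" where
  "prim_val p T D b = {z. \<not> (p dvd fst z \<and> p dvd snd z) \<and> exact_val p b (nform T D z)}"

definition cong2 :: "int \<Rightarrow> int \<times> int \<Rightarrow> int \<times> int \<Rightarrow> bool" where
  "cong2 k z z' \<longleftrightarrow> k dvd fst z' - fst z \<and> k dvd snd z' - snd z"

definition mod2 :: "int \<Rightarrow> int \<times> int \<Rightarrow> int \<times> int" where
  "mod2 k z = (fst z mod k, snd z mod k)"

lemma mod2_eq_iff: "mod2 k z = mod2 k z' \<longleftrightarrow> cong2 k z' z"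
  by (auto simp: mod2_def cong2_def mod_eq_dvd_iff)

lemma finite_mod2_image:
  assumes "k > 0"
  shows "finite (mod2 k ` A)"
proof (rule finite_subset)
  show "mod2 k ` A \<subseteq> {0..<k} \<times> {0..<k}" using assms by (auto simp: mod2_def)
qed simp

lemma cong2_trans: "cong2 k u v \<Longrightarrow> cong2 k v w \<Longrightarrow> cong2 k u w"
  by (simp add: mod2_eq_iff[symmetric])

lemma cong2_sym: "cong2 k u v \<Longrightarrow> cong2 k v u"
  by (simp add: mod2_eq_iff[symmetric])

definition lifts :: "int \<Rightarrow> int \<Rightarrow> int \<Rightarrow> nat \<Rightarrow> nat \<Rightarrow> int \<times> int \<Rightarrow> (int \<times> int) set" where
  "lifts p T D b m z = mod2 (p ^ Suc m) ` {z' \<in> prim_val p T D b. cong2 (p ^ m) z z'}"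

lemma lifts_cong:
  assumes "cong2 (p ^ m) z1 z2"
  shows "lifts p T D b m z1 = lifts p T D b m z2"
  unfolding lifts_def using assms cong2_trans cong2_sym by (metis (no_types, lifting))

text \<open>Comparisons of fibres come from explicit maps \<open>h\<close> on integer vectors.
  Inequalities suffice, since exchanging \<open>z1\<close> and \<open>z2\<close> gives the reverse
  ones.\<close>

lemma card_lifts_le:
  assumes "prime p"
    and "\<And>z. z \<in> prim_val p T D b \<Longrightarrow> cong2 (p ^ m) z1 z \<Longrightarrow> h z \<in> prim_val p T D b \<and> cong2 (p ^ m) z2 (h z)"
    and "\<And>z z'. cong2 (p ^ Suc m) (h z) (h z') \<Longrightarrow> cong2 (p ^ Suc m) z z'"
  shows "card (lifts p T D b m z1) \<le> card (lifts p T D b m z2)"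
  unfolding lifts_def
proof (rule card_image_le_by_lifting[where h = h])
  show "finite (mod2 (p ^ Suc m) ` {z' \<in> prim_val p T D b. cong2 (p ^ m) z2 z'})"
    by (rule finite_mod2_image) (use assms(1) prime_gt_0_int in simp)
qed (use assms in \<open>auto simp: mod2_eq_iff\<close>)

lemma nform_cong:
  assumes "cong2 k z z'"
  shows "k dvd nform T D z' - nform T D z"
proof -
  obtain s t where "fst z' = fst z + k * s" "snd z' = snd z + k * t"
    using assms unfolding cong2_def by (metis add.commute diff_add_cancel dvdE)
  then have "nform T D z' - nform T D z = k * (s * (2 * fst z + T * snd z) + t * (T * fst z + 2 * D * snd z)
     + k * (s\<^sup>2 + T * s * t + D * t\<^sup>2))"
    unfolding nform_def by (simp add: algebra_simps power2_eq_square)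
  then show ?thesis by simp
qed

lemma prim_val_cong:
  assumes "cong2 (p ^ Suc b) z z'" "z \<in> prim_val p T D b"
  shows "z' \<in> prim_val p T D b"
proof -
  have "exact_val p b (nform T D z')"
    using assms nform_cong[OF assms(1)] exact_val_cong unfolding prim_val_def by blast
  moreover have "cong2 p z z'"
    using assms(1) unfolding cong2_def by (metis dvd_mult_left power_Suc)
  ultimately show ?thesis using assms(2) unfolding prim_val_def cong2_def
    by (metis (no_types, lifting) dvd_diff_right_iff mem_Collect_eq)
qed

text \<open>The affine map \<open>h\<close> sends \<open>z1\<close> to \<open>z2\<close> and scales
  differences by \<open>c\<close>. It multiplies the form by \<open>c\<close> up to an error that
  \<open>p ^ Suc b\<close> divides, so exact valuation \<open>b\<close> survives.\<close>

lemma card_lifts_le_near: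
  assumes p: "prime p" and m: "0 < m" "b < 2 * m"
    and j: "b \<le> 2 * j"
    and z: "z1 \<in> prim_val p T D b" "z2 \<in> prim_val p T D b" "cong2 (p ^ j) z1 z2"
  shows "card (lifts p T D b m z1) \<le> card (lifts p T D b m z2)"
proof -
  obtain x1 y1 x2 y2 where [simp]: "z1 = (x1, y1)" "z2 = (x2, y2)" by fastforce
  obtain c where c: "\<not> p dvd c" "p ^ Suc b dvd c * nform T D z1 - nform T D z2"
    using exact_val_proportional[OF p] z unfolding prim_val_def by blast
  define h where "h z = (x2 + c * (fst z - x1), y2 + c * (snd z - y1))" for z
  show ?thesis
  proof (rule card_lifts_le[where h = h, OF p])
    fix z z' assume "cong2 (p ^ Suc m) (h z) (h z')"
    then have "p ^ Suc m dvd c * (fst z' - fst z)" "p ^ Suc m dvd c * (snd z' - snd z)"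
      unfolding cong2_def h_def by (simp_all add: algebra_simps)
    then show "cong2 (p ^ Suc m) z z'"
      unfolding cong2_def by (simp add: prime_power_dvd_unit_mult_iff[OF p c(1)] del: power_Suc)
  next
    fix z assume V: "z \<in> prim_val p T D b" and near: "cong2 (p ^ m) z1 z"
    obtain s t where st: "fst z = x1 + p ^ m * s" "snd z = y1 + p ^ m * t"
      using near unfolding cong2_def by (metis add.commute diff_add_cancel dvdE fst_conv snd_conv \<open>z1 = (x1, y1)\<close>)
    obtain u v where uv: "x2 = x1 + p ^ j * u" "y2 = y1 + p ^ j * v"
      using z(3) unfolding cong2_def by (metis add.commute diff_add_cancel dvdE fst_conv snd_conv \<open>z1 = (x1, y1)\<close> \<open>z2 = (x2, y2)\<close>)
    have hz: "h z = (x2 + p ^ m * (c * s), y2 + p ^ m * (c * t))"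
      unfolding h_def st by (simp add: algebra_simps)
    have h_near: "cong2 (p ^ m) z2 (h z)" unfolding hz cong2_def by simp
    \<comment> \<open>The terms linear in \<open>s\<close>, \<open>t\<close> combine to the bilinear
      form at \<open>z2 - z1\<close>, which contributes the factor \<open>p ^ j\<close>; the
      quadratic terms carry \<open>p ^ m\<close> twice.\<close>
    have "nform T D (h z) - c * nform T D z = - (c * nform T D z1 - nform T D z2)
       + p ^ m * p ^ j * (c * (s * (2 * u + T * v) + t * (T * u + 2 * D * v)))
       + p ^ m * p ^ m * ((c\<^sup>2 - c) * (s\<^sup>2 + T * s * t + D * t\<^sup>2))"
      unfolding hz nform_def st uv by (simp add: st uv algebra_simps power2_eq_square)
    \<comment> \<open>Adding \<open>2 * m \<ge> b + 1\<close> and \<open>2 * j \<ge> b\<close> gives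
      \<open>2 * (m + j) \<ge> 2 * b + 1\<close>, hence \<open>m + j \<ge> Suc b\<close>.\<close>
    moreover have "p ^ Suc b dvd p ^ m * p ^ j" "p ^ Suc b dvd p ^ m * p ^ m"
      unfolding power_add[symmetric] by (rule le_imp_power_dvd, use m j in linarith)+
    ultimately have "p ^ Suc b dvd nform T D (h z) - c * nform T D z"
      using c(2) by (metis dvd_add dvd_minus_iff dvd_mult2)
    then have "exact_val p b (nform T D (h z))"
      using V exact_val_cong exact_val_unit_mult[OF p c(1)] unfolding prim_val_def by blast
    moreover have "cong2 p z2 (h z)"
      using h_near m(1) unfolding cong2_def by (meson dvd_power dvd_trans)
    then have "\<not> (p dvd fst (h z) \<and> p dvd snd (h z))"
      using z(2) unfolding prim_val_def cong2_def by (metis (no_types, lifting) dvd_diff_right_iff mem_Collect_eq)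
    ultimately show "h z \<in> prim_val p T D b \<and> cong2 (p ^ m) z2 (h z)"
      using h_near unfolding prim_val_def by blast
  qed
qed

text \<open>Scaling a vector by \<open>c\<close> multiplies the form by the square of
  \<open>c\<close>, which is prime to \<open>p\<close>.\<close>

lemma card_lifts_le_scale:
  assumes p: "prime p" and c: "\<not> p dvd c"
  shows "card (lifts p T D b m (x, y)) \<le> card (lifts p T D b m (c * x, c * y))"
proof (rule card_lifts_le[where h = "\<lambda>z. (c * fst z, c * snd z)", OF p])
  fix z z' :: "int \<times> int" assume "cong2 (p ^ Suc m) (c * fst z, c * snd z) (c * fst z', c * snd z')"
  then show "cong2 (p ^ Suc m) z z'"
    unfolding cong2_def 
    by (simp add: prime_power_dvd_unit_mult_iff[OF p c] right_diff_distrib[symmetric] del: power_Suc)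
next
  fix z assume V: "z \<in> prim_val p T D b" "cong2 (p ^ m) (x, y) z"
  have "nform T D (c * fst z, c * snd z) = c * (c * nform T D z)"
    unfolding nform_def by (simp add: algebra_simps power2_eq_square)
  then show "(c * fst z, c * snd z) \<in> prim_val p T D b \<and> cong2 (p ^ m) (c * x, c * y) (c * fst z, c * snd z)"
    using V c p exact_val_unit_mult[OF p c] unfolding prim_val_def cong2_def
    by (auto simp: prime_dvd_mult_iff right_diff_distrib[symmetric])
qed

lemma prim_val_scale:
  assumes p: "prime p" and c: "\<not> p dvd c" and "(x, y) \<in> prim_val p T D b"
  shows "(c * x, c * y) \<in> prim_val p T D b"
proof -
  have "nform T D (c * x, c * y) = c * (c * nform T D (x, y))"
    unfolding nform_def by (simp add: algebra_simps power2_eq_square)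
  then show ?thesis
    using assms exact_val_unit_mult[OF p c] unfolding prim_val_def
    by (auto simp: prime_dvd_mult_iff)
qed

text \<open>The map is minus the conjugation of the quadratic ring: \<open>x + y w\<close> has
  conjugate \<open>(x + T * y) - y w\<close>. The sign is chosen so that the second coordinate stays
  fixed.\<close>

lemma nform_conj: "nform T D (- x - T * y, y) = nform T D (x, y)"
  unfolding nform_def by (simp add: algebra_simps power2_eq_square)

lemma prim_val_conj:
  assumes "(x, y) \<in> prim_val p T D b"
  shows "(- x - T * y, y) \<in> prim_val p T D b"
proof -
  have "p dvd x" if "p dvd - x - T * y" "p dvd y"
    using dvd_add[OF that(1) dvd_mult[OF that(2), of T]] by simp
  then show ?thesis using assms unfolding prim_val_def by (auto simp: nform_conj)
qed

lemma card_lifts_le_conj: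
  assumes p: "prime p"
  shows "card (lifts p T D b m (x, y)) \<le> card (lifts p T D b m (- x - T * y, y))"
proof (rule card_lifts_le[where h = "\<lambda>z. (- fst z - T * snd z, snd z)", OF p])
  fix z z' :: "int \<times> int"
  assume *: "cong2 (p ^ Suc m) (- fst z - T * snd z, snd z) (- fst z' - T * snd z', snd z')"
  have "fst z' - fst z = - ((- fst z' - T * snd z') - (- fst z - T * snd z)) - T * (snd z' - snd z)"
    by (simp add: algebra_simps)
  with * show "cong2 (p ^ Suc m) z z'" unfolding cong2_def fst_conv snd_conv
    by (metis dvd_diff dvd_minus_iff dvd_mult)
next
  fix z assume V: "z \<in> prim_val p T D b" "cong2 (p ^ m) (x, y) z"
  have "(- fst z - T * snd z) - (- x - T * y) = - (fst z - x) - T * (snd z - y)"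
    by (simp add: algebra_simps)
  then have "cong2 (p ^ m) (- x - T * y, y) (- fst z - T * snd z, snd z)"
    using V(2) unfolding cong2_def fst_conv snd_conv by (metis dvd_diff dvd_minus_iff dvd_mult)
  then show "(- fst z - T * snd z, snd z) \<in> prim_val p T D b \<and>
     cong2 (p ^ m) (- x - T * y, y) (- fst z - T * snd z, snd z)"
    using V prim_val_conj[of "fst z" "snd z"] by simp
qed

lemma card_lifts_le_same_snd:
  assumes p: "prime p" and m: "0 < m"
    and z: "(x1, y) \<in> prim_val p T D b" "(x2, y) \<in> prim_val p T D b"
  shows "card (lifts p T D b m (x1, y)) \<le> card (lifts p T D b m (x2, y))"
proof -
  \<comment> \<open>\<open>b / 2\<close> rounded up is the largest exponent that the factorisation
    below yields and the smallest that \<open>card_lifts_le_near\<close> accepts.\<close>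
  define j where "j = Suc b div 2"
  have j: "2 * j \<le> Suc b" "b \<le> 2 * j" unfolding j_def by auto
  have near: "card (lifts p T D b m (x, y)) \<le> card (lifts p T D b m (x2, y))"
    if "(x, y) \<in> prim_val p T D b" "p ^ j dvd x2 - x" for x
  proof (cases "b < 2 * m")
    case True
    then show ?thesis using card_lifts_le_near[OF p m True j(2) that(1) z(2)] that
      unfolding cong2_def by simp
  next
    case False
    \<comment> \<open>Here \<open>2 * m \<le> b\<close>, so closeness modulo \<open>p ^ j\<close>
      already puts both vectors in one class modulo \<open>p ^ m\<close>.\<close>
    then have "m \<le> j" unfolding j_def by linarith
    then have "cong2 (p ^ m) (x, y) (x2, y)"
      using that(2) unfolding cong2_def by (auto intro: dvd_trans le_imp_power_dvd)
    then show ?thesis using lifts_cong by simp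
  qed
  \<comment> \<open>With \<open>y\<close> fixed the form is a monic quadratic in the first
    coordinate that takes the same value at \<open>x1\<close> and at its conjugate
    \<open>- x1 - T * y\<close>.\<close>
  have "nform T D (x2, y) - nform T D (x1, y) = (x2 - x1) * (x2 - (- x1 - T * y))"
    unfolding nform_def by (simp add: algebra_simps power2_eq_square)
  moreover have "p ^ b dvd nform T D (x2, y) - nform T D (x1, y)"
    using z unfolding prim_val_def exact_val_def by auto
  ultimately consider "p ^ j dvd x2 - x1" | "p ^ j dvd x2 - (- x1 - T * y)"
    using prime_power_dvd_mult_half[OF p _ j(1)] by metis
  then show ?thesis
  proof cases
    case 1 then show ?thesis using near z(1) by blast
  next
    case 2
    then show ?thesis using near prim_val_conj[OF z(1)] card_lifts_le_conj[OF p] le_trans by blast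
  qed
qed

lemma card_lifts_le_prim_val:
  assumes p: "prime p" and m: "0 < m"
    and z: "z1 \<in> prim_val p T D b" "z2 \<in> prim_val p T D b"
  shows "card (lifts p T D b m z1) \<le> card (lifts p T D b m z2)"
proof (cases "b = 0")
  case True
  \<comment> \<open>For \<open>b = 0\<close> the exponent \<open>j = 0\<close> is admissible, so any
    two vectors count as close.\<close>
  show ?thesis
    by (rule card_lifts_le_near[where j = 0, OF p m _ _ z]) (use True m in \<open>auto simp: cong2_def\<close>)
next
  case False
  obtain x1 y1 x2 y2 where zz: "z1 = (x1, y1)" "z2 = (x2, y2)" by fastforce
  \<comment> \<open>if p divides the form and y, then it divides x as well\<close>
  have unit: "\<not> p dvd y" if "(x, y) \<in> prim_val p T D b" for x y
  proof
    assume "p dvd y"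
    moreover have "p dvd nform T D (x, y)"
      using that False unfolding prim_val_def exact_val_def by (auto intro: dvd_trans dvd_power)
    moreover have "nform T D (x, y) = x\<^sup>2 + y * (T * x + D * y)"
      unfolding nform_def by (simp add: algebra_simps power2_eq_square)
    ultimately have "p dvd x" using p by (metis dvd_add_left_iff dvd_mult2 prime_dvd_power)
    then show False using that \<open>p dvd y\<close> unfolding prim_val_def by auto
  qed
  have u: "\<not> p dvd y1" "\<not> p dvd y2" using unit z zz by auto
  \<comment> \<open>The precision covers two uses: \<open>Suc b\<close> digits keep the adjusted
    vector in \<open>prim_val\<close>, and \<open>m\<close> digits keep its fibre.\<close>
  define N where "N = Suc b + m"
  obtain y' where y': "p ^ N dvd y1 * y' - 1" using unit_mod_prime_power[OF p u(1)] .
  \<comment> \<open>The quotient of \<open>y2\<close> by \<open>y1\<close> modulo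
    \<open>p ^ N\<close>; scaling \<open>z1\<close> by it matches the second coordinates.\<close>
  define c where "c = y2 * y'"
  have cy: "p ^ N dvd c * y1 - y2"
    using dvd_mult[OF y', of y2] unfolding c_def by (simp add: algebra_simps)
  have "p dvd c * y1 - y2" using cy unfolding N_def by (metis add_Suc dvd_mult_left power_Suc)
  then have c: "\<not> p dvd c" using u(2) by (metis dvd_diff_right_iff dvd_mult2)
  have near: "cong2 (p ^ k) (c * x1, c * y1) (c * x1, y2)" if "k \<le> N" for k
    using cy that unfolding cong2_def
    by (auto simp: dvd_diff_commute intro: dvd_trans le_imp_power_dvd)
  have "(c * x1, y2) \<in> prim_val p T D b"
    using prim_val_cong[OF near] prim_val_scale[OF p c] z zz N_def by auto
  then have "card (lifts p T D b m (c * x1, y2)) \<le> card (lifts p T D b m z2)"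
    using card_lifts_le_same_snd[OF p m] z zz by blast
  then show ?thesis
    using card_lifts_le_scale[OF p c, of T D b m x1 y1] lifts_cong[OF near[of m], of T D b]
    unfolding zz N_def by simp
qed

theorem card_lifts_eq:
  assumes "prime p" "0 < m" "z1 \<in> prim_val p T D b" "z2 \<in> prim_val p T D b"
  shows "card (lifts p T D b m z1) = card (lifts p T D b m z2)"
  using card_lifts_le_prim_val assms by (meson le_antisym)

section \<open>Cartan subgroups and the level\<close>

lemma red_eq_iff:
  "red k (a,b,c,d) = red k (a',b',c',d') \<longleftrightarrow>
   k dvd a - a' \<and> k dvd b - b' \<and> k dvd c - c' \<and> k dvd d - d'"
  by (simp add: red_def mod_eq_dvd_iff)

lemma red_red: "k dvd k' \<Longrightarrow> red k (red k' M) = red k M"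
  by (cases M) (simp add: red_def mod_mod_cancel)

lemma red_cong_dvd: "k dvd k' \<Longrightarrow> red k' M = red k' N \<Longrightarrow> red k M = red k N"
  by (metis red_red)

lemma red_idem [simp]: "red k (red k M) = red k M"
  by (simp add: red_red)

lemma red_mmul_red [simp]:
  "red k (mmul (red k A) B) = red k (mmul A B)"
  "red k (mmul A (red k B)) = red k (mmul A B)"
  by (cases A; cases B; auto simp: red_def mmul_def intro!: mod_add_cong mod_mult_cong)+

lemma red_mmul_cong:
  "red k A = red k A' \<Longrightarrow> red k B = red k B' \<Longrightarrow> red k (mmul A B) = red k (mmul A' B')"
  by (metis red_mmul_red)

lemma mmul_assoc: "mmul (mmul A B) C = mmul A (mmul B C)"
  by (cases A; cases B; cases C) (simp add: mmul_def algebra_simps)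

lemma mmul_mI [simp]: "mmul mI A = A" "mmul A mI = A"
  by (cases A; simp add: mmul_def mI_def)+

lemma mdet_mmul: "mdet (mmul A B) = mdet A * mdet B"
  by (cases A; cases B) (simp add: mdet_def mmul_def algebra_simps)

lemma mdet_mI [simp]: "mdet mI = 1"
  by (simp add: mdet_def mI_def)

lemma mdet_red: "mdet (red k A) mod k = mdet A mod k"
  by (cases A) (auto simp: mdet_def red_def intro!: mod_diff_cong mod_mult_cong)

lemma mdet_cong: "red k A = red k B \<Longrightarrow> mdet A mod k = mdet B mod k"
  by (metis mdet_red)

section \<open>Coherent sequences as l-adic integers and matrices\<close>

text \<open>An \<open>l\<close>-adic integer given by arbitrary representatives. Unlike the
  canonical ones in \<open>Zl\<close>, these are closed under pointwise ring operations, so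
  reduction can be left to the very end.\<close>

definition coherent :: "nat \<Rightarrow> (nat \<Rightarrow> int) \<Rightarrow> bool" where
  "coherent l u \<longleftrightarrow> (\<forall>k n. k \<le> n \<longrightarrow> u n mod int l ^ k = u k mod int l ^ k)"

lemma coherent_const: "coherent l (\<lambda>n. c)"
  by (simp add: coherent_def)

lemma coherent_add: "coherent l u \<Longrightarrow> coherent l v \<Longrightarrow> coherent l (\<lambda>n. u n + v n)"
  unfolding coherent_def by (intro allI impI mod_add_cong) blast+

lemma coherent_diff: "coherent l u \<Longrightarrow> coherent l v \<Longrightarrow> coherent l (\<lambda>n. u n - v n)"
  unfolding coherent_def by (intro allI impI mod_diff_cong) blast+

lemma coherent_mult: "coherent l u \<Longrightarrow> coherent l v \<Longrightarrow> coherent l (\<lambda>n. u n * v n)"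
  unfolding coherent_def by (intro allI impI mod_mult_cong) blast+

lemma coherent_uminus: "coherent l u \<Longrightarrow> coherent l (\<lambda>n. - u n)"
  unfolding coherent_def by (intro allI impI mod_minus_cong) blast

lemmas coherent_intros = coherent_const coherent_add coherent_diff coherent_mult coherent_uminus

lemma coherentI:
  assumes "\<And>n. u (Suc n) mod int l ^ n = u n mod int l ^ n"
  shows "coherent l u"
  unfolding coherent_def
proof (intro allI impI)
  fix k n :: nat assume "k \<le> n"
  then show "u n mod int l ^ k = u k mod int l ^ k"
  proof (induction n rule: dec_induct)
    case (step n)
    have "u (Suc n) mod int l ^ k = u n mod int l ^ k"
      using assms[of n] step by (metis le_imp_power_dvd mod_mod_cancel)
    then show ?case using step by simp
  qed simp
qed

lemma Zl_iff: "x \<in> Zl l \<longleftrightarrow> (\<forall>n. x n mod int l ^ n = x n) \<and> coherent l x"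
proof
  assume x: "x \<in> Zl l"
  then have "x (Suc n) mod int l ^ n = x n mod int l ^ n" for n
    unfolding Zl_def by (metis (mono_tags, lifting) mem_Collect_eq)
  then show "(\<forall>n. x n mod int l ^ n = x n) \<and> coherent l x"
    using x coherentI unfolding Zl_def by (metis (mono_tags, lifting) mem_Collect_eq)
next
  assume x: "(\<forall>n. x n mod int l ^ n = x n) \<and> coherent l x"
  then have "x (Suc n) mod int l ^ n = x n" for n
    unfolding coherent_def by (metis le_SucI le_refl)
  then show "x \<in> Zl l" using x unfolding Zl_def by simp
qed

lemma coherent_mod_Zl:
  assumes "coherent l u"
  shows "(\<lambda>n. u n mod int l ^ n) \<in> Zl l"
proof -
  have "(u n mod int l ^ n) mod int l ^ k = (u k mod int l ^ k) mod int l ^ k" if "k \<le> n" for k n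
    using that assms unfolding coherent_def by (metis le_imp_power_dvd mod_mod_cancel mod_mod_trivial)
  then show ?thesis unfolding Zl_iff coherent_def by simp
qed

lemma Zl_coherent: "x \<in> Zl l \<Longrightarrow> coherent l x"
  by (simp add: Zl_iff)

definition coherent_mat :: "nat \<Rightarrow> (nat \<Rightarrow> mat2) \<Rightarrow> bool" where
  "coherent_mat l M \<longleftrightarrow> (\<forall>k n. k \<le> n \<longrightarrow> red (int l ^ k) (M n) = red (int l ^ k) (M k))"

lemma coherent_mat_tuple:
  "coherent_mat l (\<lambda>n. (a n, b n, c n, d n)) \<longleftrightarrow>
    coherent l a \<and> coherent l b \<and> coherent l c \<and> coherent l d"
  unfolding coherent_mat_def coherent_def red_def prod.case prod.inject by blast

lemma coherent_matE:
  assumes "coherent_mat l M"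
  obtains a b c d where "M = (\<lambda>n. (a n, b n, c n, d n))"
    "coherent l a" "coherent l b" "coherent l c" "coherent l d"
proof -
  define a b c d where "a n = fst (M n)" and "b n = fst (snd (M n))"
    and "c n = fst (snd (snd (M n)))" and "d n = snd (snd (snd (M n)))" for n
  then have M: "M = (\<lambda>n. (a n, b n, c n, d n))" by auto
  then have "coherent_mat l (\<lambda>n. (a n, b n, c n, d n))" using assms by blast
  then show ?thesis using that[OF M] by (simp add: coherent_mat_tuple)
qed

lemma coherent_mat_mmul:
  "coherent_mat l A \<Longrightarrow> coherent_mat l B \<Longrightarrow> coherent_mat l (\<lambda>n. mmul (A n) (B n))"
  unfolding coherent_mat_def using red_mmul_cong by blast

lemma coherent_mdet:
  "coherent_mat l A \<Longrightarrow> coherent l (\<lambda>n. mdet (A n))"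
  unfolding coherent_mat_def coherent_def using mdet_cong by blast

lemma Matl_iff: "M \<in> Matl l \<longleftrightarrow> (\<forall>n. red (int l ^ n) (M n) = M n) \<and> coherent_mat l M"
proof
  assume M: "M \<in> Matl l"
  have "red (int l ^ k) (M n) = red (int l ^ k) (M k)" if "k \<le> n" for k n
    using that
  proof (induction n rule: dec_induct)
    case (step n)
    have "red (int l ^ n) (M (Suc n)) = red (int l ^ n) (M n)"
      using M unfolding Matl_def by (metis (mono_tags, lifting) mem_Collect_eq)
    then have "red (int l ^ k) (M (Suc n)) = red (int l ^ k) (M n)"
      using step le_imp_power_dvd red_cong_dvd by blast
    then show ?case using step by simp
  qed simp
  then show "(\<forall>n. red (int l ^ n) (M n) = M n) \<and> coherent_mat l M"
    using M unfolding Matl_def coherent_mat_def by (metis (mono_tags, lifting) mem_Collect_eq)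
next
  assume M: "(\<forall>n. red (int l ^ n) (M n) = M n) \<and> coherent_mat l M"
  then have "red (int l ^ n) (M (Suc n)) = M n" for n
    unfolding coherent_mat_def by (metis le_SucI le_refl)
  then show "M \<in> Matl l" using M unfolding Matl_def by simp
qed

lemma coherent_red_Matl:
  assumes "coherent_mat l M"
  shows "(\<lambda>n. red (int l ^ n) (M n)) \<in> Matl l"
proof -
  have "red (int l ^ k) (red (int l ^ n) (M n)) = red (int l ^ k) (red (int l ^ k) (M k))" if "k \<le> n" for k n
    using that assms unfolding coherent_mat_def by (metis le_imp_power_dvd red_red red_idem)
  then show ?thesis unfolding Matl_iff coherent_mat_def by simp
qed

lemma Matl_red: "M \<in> Matl l \<Longrightarrow> k \<le> n \<Longrightarrow> red (int l ^ k) (M n) = M k"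
  unfolding Matl_iff coherent_mat_def by metis

lemma Matl_red_self: "M \<in> Matl l \<Longrightarrow> red (int l ^ n) (M n) = M n"
  by (simp add: Matl_red)

lemma Matl_lmul: "A \<in> Matl l \<Longrightarrow> B \<in> Matl l \<Longrightarrow> lmul l A B \<in> Matl l"
  unfolding lmul_def by (rule coherent_red_Matl, rule coherent_mat_mmul) (simp_all add: Matl_iff)

lemma lmul_assoc: "lmul l (lmul l A B) C = lmul l A (lmul l B C)"
  by (simp add: lmul_def mmul_assoc)

lemma lmul_lI_left: "M \<in> Matl l \<Longrightarrow> lmul l (lI l) M = M"
  by (simp add: lmul_def lI_def Matl_red_self)

lemma lmul_lI_right: "M \<in> Matl l \<Longrightarrow> lmul l M (lI l) = M"
  by (simp add: lmul_def lI_def Matl_red_self)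

lemma lI_Matl: "lI l \<in> Matl l"
  unfolding lI_def by (rule coherent_red_Matl) (simp add: coherent_mat_def)

lemma GL2_Matl: "M \<in> GL2 l \<Longrightarrow> M \<in> Matl l"
  by (simp add: GL2_def)

lemma dvd_mdet_cong: "red k A = red k B \<Longrightarrow> k dvd mdet A \<longleftrightarrow> k dvd mdet B"
  by (metis mdet_cong dvd_eq_mod_eq_0)

lemma GL2_lmul:
  assumes "prime l" "A \<in> GL2 l" "B \<in> GL2 l"
  shows "lmul l A B \<in> GL2 l"
proof -
  have "int l dvd mdet (lmul l A B 1) \<longleftrightarrow> int l dvd mdet (mmul (A 1) (B 1))"
    by (rule dvd_mdet_cong) (simp add: lmul_def)
  then show ?thesis using assms
    by (auto simp: GL2_def Matl_lmul mdet_mmul prime_dvd_mult_iff)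
qed

text \<open>The determinant of a product is a unit only if both factors have unit determinant. This
  puts inverses and conjugates into \<open>GL2\<close> without computing their determinants.\<close>

lemma GL2_factor:
  assumes "A \<in> Matl l" "B \<in> Matl l" "lmul l A B \<in> GL2 l"
  shows "A \<in> GL2 l" "B \<in> GL2 l"
proof -
  have "int l dvd mdet (lmul l A B 1) \<longleftrightarrow> int l dvd mdet (mmul (A 1) (B 1))"
    by (rule dvd_mdet_cong) (simp add: lmul_def)
  then show "A \<in> GL2 l" "B \<in> GL2 l" using assms
    by (auto simp: GL2_def mdet_mmul)
qed

lemma lI_GL2: "prime l \<Longrightarrow> lI l \<in> GL2 l"
  using lI_Matl dvd_mdet_cong[of "int l" "lI l 1" mI]
  by (auto simp: GL2_def lI_def dest: prime_gt_1_nat)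

text \<open>Inverses exist modulo every \<open>l ^ n\<close>, and their uniqueness modulo
  \<open>l ^ n\<close> forces the independently chosen ones to be coherent.\<close>

lemma coherent_inverse:
  assumes "prime l" "coherent l u" "\<not> int l dvd u 1"
  obtains i where "i \<in> Zl l" "\<And>n. int l ^ n dvd u n * i n - 1"
proof -
  have p: "prime (int l)" using assms(1) by simp
  have unit: "\<not> int l dvd u n" if "1 \<le> n" for n
  proof -
    have "u n mod int l ^ 1 = u 1 mod int l ^ 1" using that assms(2) unfolding coherent_def by blast
    then show ?thesis using assms(3) by (simp add: dvd_eq_mod_eq_0)
  qed
  have "\<exists>c. int l ^ n dvd u n * c - 1" for n
  proof (cases "n = 0")
    case False
    then show ?thesis using unit_mod_prime_power[OF p unit] by (metis One_nat_def Suc_leI neq0_conv)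
  qed simp
  then obtain c where c: "\<And>n. int l ^ n dvd u n * c n - 1" by metis
  have "coherent l c"
  proof (rule coherentI)
    fix n
    show "c (Suc n) mod int l ^ n = c n mod int l ^ n"
    proof (cases "n = 0")
      case False
      have "int l ^ n dvd u (Suc n) * c (Suc n) - 1" using c[of "Suc n"] by (metis dvd_mult_right power_Suc)
      moreover have "int l ^ n dvd u (Suc n) - u n"
        using assms(2) unfolding coherent_def by (metis le_SucI le_refl mod_eq_dvd_iff)
      ultimately have "int l ^ n dvd (u (Suc n) * c (Suc n) - 1) - (u (Suc n) - u n) * c (Suc n) - (u n * c n - 1)"
        using c[of n] by (meson dvd_diff dvd_mult2)
      then have "int l ^ n dvd u n * (c (Suc n) - c n)" by (simp add: algebra_simps)
      then have "int l ^ n dvd c (Suc n) - c n"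
        using prime_power_dvd_unit_mult_iff[OF p unit] False by auto
      then show ?thesis by (simp add: mod_eq_dvd_iff)
    qed simp
  qed
  then have "(\<lambda>n. c n mod int l ^ n) \<in> Zl l" by (rule coherent_mod_Zl)
  moreover have "int l ^ n dvd u n * (c n mod int l ^ n) - 1" for n
  proof -
    have "(u n * (c n mod int l ^ n) - 1) mod int l ^ n = (u n * c n - 1) mod int l ^ n"
      by (intro mod_diff_cong mod_mult_cong) simp_all
    then show ?thesis using c[of n] by (simp add: dvd_eq_mod_eq_0)
  qed
  ultimately show ?thesis using that by blast
qed

lemma GL2_inverse:
  assumes "prime l" "A \<in> GL2 l"
  obtains B where "B \<in> Matl l" "lmul l A B = lI l" "lmul l B A = lI l"
proof -
  have cA: "coherent_mat l A" using assms(2) by (simp add: GL2_def Matl_iff)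
  obtain i where i: "i \<in> Zl l" "\<And>n. int l ^ n dvd mdet (A n) * i n - 1"
    using coherent_inverse[OF assms(1) coherent_mdet[OF cA]] assms(2) unfolding GL2_def by blast
  obtain a b c d where A: "A = (\<lambda>n. (a n, b n, c n, d n))"
    and co: "coherent l a" "coherent l b" "coherent l c" "coherent l d"
    using coherent_matE[OF cA] .
  \<comment> \<open>The adjugate of \<open>A\<close> times the inverse \<open>i\<close> of its
    determinant.\<close>
  define B where "B n = red (int l ^ n) (i n * d n, - (i n * b n), - (i n * c n), i n * a n)" for n
  have "B \<in> Matl l"
    unfolding B_def by (rule coherent_red_Matl)
      (simp add: coherent_mat_tuple coherent_intros co Zl_coherent[OF i(1)])
  moreover have "red (int l ^ n) (mmul (A n) (B n)) = red (int l ^ n) mI" for n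
    using i(2)[of n] unfolding B_def A red_mmul_red mI_def mdet_def
    by (simp add: mmul_def red_eq_iff algebra_simps)
  moreover have "red (int l ^ n) (mmul (B n) (A n)) = red (int l ^ n) mI" for n
    using i(2)[of n] unfolding B_def A red_mmul_red mI_def mdet_def
    by (simp add: mmul_def red_eq_iff algebra_simps)
  ultimately show ?thesis using that unfolding lmul_def lI_def by simp
qed

section \<open>The unit group of a quadratic order\<close>

text \<open>The matrix \<open>x * I + y * W\<close>: multiplication by \<open>x + y w\<close> when
  \<open>W\<close> is multiplication by \<open>w\<close>.\<close>

definition mlin :: "int \<Rightarrow> int \<Rightarrow> mat2 \<Rightarrow> mat2" where
  "mlin x y W = (case W of (a,b,c,d) \<Rightarrow> (x + y * a, y * b, y * c, x + y * d))"

definition mtr :: "mat2 \<Rightarrow> int" where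
  "mtr W = (case W of (a,b,c,d) \<Rightarrow> a + d)"

lemma mlin_red: "red k (mlin x y (red k W)) = red k (mlin x y W)"
  by (cases W) (auto simp: mlin_def red_def intro!: mod_add_cong mod_mult_cong)

lemma mlin_cong:
  assumes "x mod k = x' mod k" "y mod k = y' mod k" "red k W = red k W'"
  shows "red k (mlin x y W) = red k (mlin x' y' W')"
proof -
  have "red k (mlin x y W) = red k (mlin (x mod k) (y mod k) W)" for x y W
    by (cases W) (auto simp: mlin_def red_def intro!: mod_add_cong mod_mult_cong)
  then show ?thesis using assms by (metis mlin_red)
qed

text \<open>By Cayley-Hamilton the square of \<open>W\<close> is
  \<open>mtr W * W - mdet W * I\<close>.\<close>

lemma mlin_mmul:
  "mmul (mlin x y W) (mlin x' y' W) =
   mlin (x * x' - y * y' * mdet W) (x * y' + x' * y + y * y' * mtr W) W"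
  by (cases W) (simp add: mlin_def mmul_def mdet_def mtr_def algebra_simps)

text \<open>This link between determinant and norm turns conditions on matrices into the conditions
  on vectors in \<open>prim_val\<close>.\<close>

lemma mdet_mlin: "mdet (mlin x y W) = nform (mtr W) (mdet W) (x, y)"
  by (cases W) (simp add: mlin_def mdet_def mtr_def nform_def algebra_simps power2_eq_square)

lemma mtr_cong: "red k A = red k B \<Longrightarrow> mtr A mod k = mtr B mod k"
  by (cases A; cases B) (auto simp: mtr_def red_def intro: mod_add_cong)

text \<open>Scalars commute with \<open>P\<close>, so a base change that carries \<open>S\<close> to
  \<open>W\<close> carries the whole algebra generated by \<open>S\<close> along, with the same
  coordinates \<open>x\<close>, \<open>y\<close>.\<close>

lemma mlin_intertwine:
  assumes "red k (mmul P S) = red k (mmul W P)"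
  shows "red k (mmul P (mlin x y S)) = red k (mmul (mlin x y W) P)"
proof -
  obtain p q r s where P: "P = (p, q, r, s)" using prod_cases4 .
  obtain a b c d where S: "S = (a, b, c, d)" using prod_cases4 .
  obtain a' b' c' d' where W: "W = (a', b', c', d')" using prod_cases4 .
  have "k dvd (p * a + q * c) - (a' * p + b' * r)" "k dvd (p * b + q * d) - (a' * q + b' * s)"
    "k dvd (r * a + s * c) - (c' * p + d' * r)" "k dvd (r * b + s * d) - (c' * q + d' * s)"
    using assms unfolding P S W mmul_def prod.case red_eq_iff by blast+
  moreover have
    "(p * (x + y * a) + q * (y * c)) - ((x + y * a') * p + y * b' * r) = y * ((p * a + q * c) - (a' * p + b' * r))"
    "(p * (y * b) + q * (x + y * d)) - ((x + y * a') * q + y * b' * s) = y * ((p * b + q * d) - (a' * q + b' * s))"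
    "(r * (x + y * a) + s * (y * c)) - (y * c' * p + (x + y * d') * r) = y * ((r * a + s * c) - (c' * p + d' * r))"
    "(r * (y * b) + s * (x + y * d)) - (y * c' * q + (x + y * d') * s) = y * ((r * b + s * d) - (c' * q + d' * s))"
    by (simp_all add: algebra_simps)
  ultimately show ?thesis unfolding P S W mlin_def mmul_def prod.case red_eq_iff
    by (simp only: dvd_mult simp_thms)
qed

lemma coherent_mlin:
  "coherent l x \<Longrightarrow> coherent l y \<Longrightarrow> coherent_mat l W \<Longrightarrow> coherent_mat l (\<lambda>n. mlin (x n) (y n) (W n))"
  unfolding coherent_def coherent_mat_def by (intro allI impI mlin_cong) blast+

lemma coherent_mtr: "coherent_mat l A \<Longrightarrow> coherent l (\<lambda>n. mtr (A n))"
  unfolding coherent_mat_def coherent_def using mtr_cong by blast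

text \<open>The matrix \<open>W\<close> is multiplication by \<open>w\<close> in the given basis; the last assumption says that it is not
  scalar modulo \<open>l\<close>.\<close>

locale quad_order =
  fixes l :: nat and W :: "nat \<Rightarrow> mat2"
  assumes prime_l: "prime l"
    and W_Matl: "W \<in> Matl l"
    and mlin_eq_0: "\<And>k x y. red (int l ^ k) (mlin x y (W k)) = (0, 0, 0, 0) \<Longrightarrow>
      int l ^ k dvd x \<and> int l ^ k dvd y"
begin

text \<open>The Cartan subgroup in the basis in which \<open>w\<close> acts as \<open>W\<close>;
  \<open>cartan_eq_units\<close> shows that every \<open>cartan l t d P\<close> has this
  form.\<close>

definition units :: "(nat \<Rightarrow> mat2) set" where
  "units = {M \<in> GL2 l. \<exists>x\<in>Zl l. \<exists>y\<in>Zl l. \<forall>n. M n = red (int l ^ n) (mlin (x n) (y n) (W n))}"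

lemma W_coherent: "coherent_mat l W"
  using W_Matl by (simp add: Matl_iff)

lemma unitsI:
  assumes "coherent l x" "coherent l y" "\<not> int l dvd mdet (mlin (x 1) (y 1) (W 1))"
  shows "(\<lambda>n. red (int l ^ n) (mlin (x n) (y n) (W n))) \<in> units"
proof -
  let ?M = "\<lambda>n. red (int l ^ n) (mlin (x n) (y n) (W n))"
  have "?M \<in> Matl l" by (rule coherent_red_Matl, rule coherent_mlin) (use assms W_coherent in auto)
  moreover have "\<not> int l dvd mdet (?M 1)"
    using assms(3) dvd_mdet_cong[of "int l" "?M 1"] by (metis power_one_right red_idem)
  ultimately have "?M \<in> GL2 l" by (simp add: GL2_def)
  moreover have "\<forall>n. ?M n = red (int l ^ n) (mlin (x n mod int l ^ n) (y n mod int l ^ n) (W n))"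
    by (intro allI mlin_cong) auto
  then have "\<exists>x'\<in>Zl l. \<exists>y'\<in>Zl l. \<forall>n. ?M n = red (int l ^ n) (mlin (x' n) (y' n) (W n))"
    by (intro bexI[OF bexI[OF _ coherent_mod_Zl[OF assms(2)]] coherent_mod_Zl[OF assms(1)]])
  ultimately show ?thesis unfolding units_def by simp
qed

lemma units_GL2: "M \<in> units \<Longrightarrow> M \<in> GL2 l"
  by (simp add: units_def)

lemma units_Matl: "M \<in> units \<Longrightarrow> M \<in> Matl l"
  by (simp add: units_def GL2_def)

lemma unitsE:
  assumes "M \<in> units"
  obtains x y where "coherent l x" "coherent l y" "M = (\<lambda>n. red (int l ^ n) (mlin (x n) (y n) (W n)))"
  using assms Zl_coherent unfolding units_def by blast

lemma lmul_mlin: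
  "lmul l (\<lambda>n. red (int l ^ n) (mlin (x n) (y n) (W n))) (\<lambda>n. red (int l ^ n) (mlin (x' n) (y' n) (W n)))
   = (\<lambda>n. red (int l ^ n) (mlin (x n * x' n - y n * y' n * mdet (W n))
       (x n * y' n + x' n * y n + y n * y' n * mtr (W n)) (W n)))"
  by (simp add: lmul_def mlin_mmul)

lemma units_lmul:
  assumes "M \<in> units" "N \<in> units"
  shows "lmul l M N \<in> units"
proof -
  obtain x y where M: "coherent l x" "coherent l y" "M = (\<lambda>n. red (int l ^ n) (mlin (x n) (y n) (W n)))"
    using unitsE[OF assms(1)] .
  obtain x' y' where N: "coherent l x'" "coherent l y'" "N = (\<lambda>n. red (int l ^ n) (mlin (x' n) (y' n) (W n)))"
    using unitsE[OF assms(2)] .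
  have "lmul l M N \<in> GL2 l" using assms GL2_lmul prime_l units_GL2 by blast
  then have "\<not> int l dvd mdet (lmul l M N 1)" by (simp add: GL2_def)
  then show ?thesis unfolding M N lmul_mlin
    using M N W_coherent dvd_mdet_cong[OF red_idem]
    by (intro unitsI coherent_intros coherent_mdet coherent_mtr) auto
qed

lemma units_comm:
  assumes "M \<in> units" "N \<in> units"
  shows "lmul l M N = lmul l N M"
  using assms by (elim unitsE) (simp add: lmul_mlin algebra_simps)

lemma lI_eq_mlin: "lI l = (\<lambda>n. red (int l ^ n) (mlin 1 0 (W n)))"
  by (auto simp: lI_def mI_def mlin_def split: prod.split)

lemma lI_units: "lI l \<in> units"
  unfolding lI_eq_mlin
  by (rule unitsI) (use prime_l prime_gt_1_nat in \<open>auto simp: coherent_const mdet_mlin nform_def\<close>)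

lemma units_inverse:
  assumes "M \<in> units"
  obtains N where "N \<in> units" "lmul l M N = lI l" "lmul l N M = lI l"
proof -
  obtain x y where M: "coherent l x" "coherent l y" "M = (\<lambda>n. red (int l ^ n) (mlin (x n) (y n) (W n)))"
    using unitsE[OF assms] .
  let ?D = "\<lambda>n. mdet (mlin (x n) (y n) (W n))"
  have "\<not> int l dvd mdet (M 1)" using assms by (simp add: units_def GL2_def)
  then have "\<not> int l dvd ?D 1" using dvd_mdet_cong[of "int l" "M 1"] unfolding M by simp
  moreover have "coherent l ?D" by (intro coherent_mdet coherent_mlin M W_coherent)
  ultimately obtain i where i: "i \<in> Zl l" "\<And>n. int l ^ n dvd ?D n * i n - 1"
    using coherent_inverse[OF prime_l] by blast
  \<comment> \<open>\<open>u + v w\<close> is the conjugate of \<open>x + y w\<close> divided by its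
    norm.\<close>
  define u where "u n = i n * (x n + y n * mtr (W n))" for n
  define v where "v n = - (i n * y n)" for n
  define N where "N n = red (int l ^ n) (mlin (u n) (v n) (W n))" for n
  have co: "coherent l u" "coherent l v" unfolding u_def v_def
    using M W_coherent Zl_coherent[OF i(1)] by (auto intro!: coherent_intros coherent_mtr)
  have MN: "lmul l M N = lI l"
    unfolding M N_def lmul_mlin unfolding lI_eq_mlin
  proof (intro ext mlin_cong refl)
    fix n
    have "x n * u n - y n * v n * mdet (W n) - 1 = ?D n * i n - 1"
      unfolding u_def v_def mdet_mlin nform_def by (simp add: algebra_simps power2_eq_square)
    then show "(x n * u n - y n * v n * mdet (W n)) mod int l ^ n = 1 mod int l ^ n"
      using i(2)[of n] by (simp add: mod_eq_dvd_iff)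
    have "x n * v n + u n * y n + y n * v n * mtr (W n) = 0"
      unfolding u_def v_def by (simp add: algebra_simps)
    then show "(x n * v n + u n * y n + y n * v n * mtr (W n)) mod int l ^ n = 0 mod int l ^ n" by simp
  qed
  have "N \<in> Matl l" unfolding N_def by (intro coherent_red_Matl coherent_mlin co W_coherent)
  then have "N \<in> GL2 l" using GL2_factor(2) MN lI_GL2 prime_l units_Matl assms by metis
  then have "\<not> int l dvd mdet (mlin (u 1) (v 1) (W 1))"
    using dvd_mdet_cong[of "int l" "N 1"] unfolding N_def GL2_def by simp
  then have "N \<in> units" using unitsI[OF co] unfolding N_def by simp
  then show ?thesis using that MN units_comm assms by metis
qed

lemma units_divide:
  assumes "M \<in> units" "N \<in> units" "M n = N n"
  obtains K where "K \<in> units" "N = lmul l M K" "K n = lI l n"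
proof -
  obtain M' where M': "M' \<in> units" "lmul l M M' = lI l" "lmul l M' M = lI l"
    using units_inverse[OF assms(1)] .
  have "lmul l M (lmul l M' N) = N"
    by (simp add: lmul_assoc[symmetric] M' lmul_lI_left units_Matl assms)
  moreover have "lmul l M' N n = lmul l M' M n" by (simp add: lmul_def assms(3))
  ultimately show ?thesis using that[of "lmul l M' N"] units_lmul M' assms by simp
qed

section \<open>Cosets and the level\<close>

text \<open>The elements that are trivial modulo \<open>l ^ n\<close> lie in \<open>G\<close> once
  \<open>n \<ge> m\<close>. If two cosets of \<open>G\<close> agree modulo \<open>l ^ n\<close>, a
  representative of one therefore differs from an element of the other by an element of
  \<open>G\<close>.\<close>

lemma inj_on_lvl_img_cosets:
  assumes G: "open_subgroup l G units" and m: "\<forall>M\<in>units. M m = lI l m \<longrightarrow> M \<in> G" and "m \<le> n"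
  shows "inj_on (lvl_img n) ((\<lambda>M. lmul l M ` G) ` units)"
proof -
  have GU: "G \<subseteq> units" and I: "lI l \<in> G" and mul: "\<And>M N. M \<in> G \<Longrightarrow> N \<in> G \<Longrightarrow> lmul l M N \<in> G"
    using G unfolding open_subgroup_def by auto
  have sub: "lmul l M ` G \<subseteq> lmul l N ` G"
    if MN: "M \<in> units" "N \<in> units" "lvl_img n (lmul l M ` G) \<subseteq> lvl_img n (lmul l N ` G)" for M N
  proof -
    have "lmul l M (lI l) n \<in> lvl_img n (lmul l M ` G)" using I unfolding lvl_img_def by blast
    then obtain g where g: "g \<in> G" "M n = lmul l N g n"
      using MN lmul_lI_right[OF units_Matl[OF MN(1)]] unfolding lvl_img_def by auto
    have "lmul l N g \<in> units" using units_lmul MN(2) g GU by blast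
    then obtain K where K: "K \<in> units" "M = lmul l (lmul l N g) K" "K n = lI l n"
      using units_divide[OF _ MN(1)] g(2) by metis
    have "K m = lI l m" using K assms(3) Matl_red[of _ l m n] units_Matl lI_Matl by metis
    then have "K \<in> G" using m K(1) by blast
    show ?thesis
    proof
      fix X assume "X \<in> lmul l M ` G"
      then obtain h where h: "h \<in> G" "X = lmul l M h" by blast
      then have "X = lmul l N (lmul l g (lmul l K h))" unfolding K(2) by (simp add: lmul_assoc)
      moreover have "lmul l g (lmul l K h) \<in> G" by (intro mul g(1) h(1) \<open>K \<in> G\<close>)
      ultimately show "X \<in> lmul l N ` G" by (rule image_eqI)
    qed
  qed
  show ?thesis
  proof (rule inj_onI)
    fix X Y assume XY: "X \<in> (\<lambda>M. lmul l M ` G) ` units" "Y \<in> (\<lambda>M. lmul l M ` G) ` units"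
      "lvl_img n X = lvl_img n Y"
    then obtain M N where "M \<in> units" "N \<in> units" "X = lmul l M ` G" "Y = lmul l N ` G" by blast
    then show "X = Y" using sub[of M N] sub[of N M] XY(3) by auto
  qed
qed

lemma finite_lvl_img:
  assumes "X \<subseteq> Matl l"
  shows "finite (lvl_img n X)"
proof -
  have "lvl_img n X \<subseteq> {0..<int l ^ n} \<times> {0..<int l ^ n} \<times> {0..<int l ^ n} \<times> {0..<int l ^ n}"
  proof
    fix A assume "A \<in> lvl_img n X"
    then obtain M where "M \<in> Matl l" "A = M n" using assms unfolding lvl_img_def by blast
    then have "red (int l ^ n) A = A" by (simp add: Matl_red_self)
    moreover have "0 \<le> x \<and> x < int l ^ n" if "x mod int l ^ n = x" for x
      using pos_mod_sign[of "int l ^ n" x] pos_mod_bound[of "int l ^ n" x] that prime_gt_0_nat[OF prime_l] by simp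
    moreover obtain a b c d where "A = (a, b, c, d)" using prod_cases4 .
    ultimately show "A \<in> {0..<int l ^ n} \<times> {0..<int l ^ n} \<times> {0..<int l ^ n} \<times> {0..<int l ^ n}"
      by (simp add: red_def)
  qed
  then show ?thesis by (rule finite_subset) simp
qed

lemma index_l_units: "index_l l units G = card ((\<lambda>M. lmul l M ` G) ` units)"
  by (simp add: index_l_def Setcompr_eq_image)

text \<open>The index at level \<open>n\<close> counts the reductions of the very cosets that the
  full index counts. Equality of the two indices thus becomes injectivity of reduction on
  cosets.\<close>

lemma index_n_units: "index_n l n units G = card (lvl_img n ` (\<lambda>M. lmul l M ` G) ` units)"
proof -
  have "{(\<lambda>g. red (int l ^ n) (mmul A g)) ` lvl_img n G | A. A \<in> lvl_img n units} =
      lvl_img n ` (\<lambda>M. lmul l M ` G) ` units"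
    unfolding Setcompr_eq_image lvl_img_def image_image by (simp add: lmul_def)
  then show ?thesis by (simp add: index_n_def)
qed

lemma level_attained:
  assumes "open_subgroup l G units"
  shows "0 < level l units G" "index_n l (level l units G) units G = index_l l units G"
proof -
  obtain m where m: "\<forall>M\<in>units. M m = lI l m \<longrightarrow> M \<in> G"
    using assms unfolding open_subgroup_def by blast
  \<comment> \<open>\<open>Suc m\<close> instead of \<open>m\<close>, because the level ranges over
    positive integers.\<close>
  have "index_n l (Suc m) units G = index_l l units G"
    unfolding index_n_units index_l_units
    by (rule card_image, rule inj_on_lvl_img_cosets[OF assms m]) simp
  then show "0 < level l units G" "index_n l (level l units G) units G = index_l l units G"
    unfolding level_def
    using LeastI[of "\<lambda>n. 0 < n \<and> index_n l n units G = index_l l units G" "Suc m"] by simp_all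
qed

text \<open>Openness embeds the cosets into the subsets of a finite set of matrices. Finiteness is
  what later lets equal cardinalities imply injectivity.\<close>

lemma finite_cosets:
  assumes "open_subgroup l G units"
  shows "finite ((\<lambda>M. lmul l M ` G) ` units)"
proof -
  have GU: "G \<subseteq> units" using assms unfolding open_subgroup_def by auto
  obtain m where m: "\<forall>M\<in>units. M m = lI l m \<longrightarrow> M \<in> G"
    using assms unfolding open_subgroup_def by blast
  show ?thesis
  proof (rule finite_imageD)
    show "inj_on (lvl_img m) ((\<lambda>M. lmul l M ` G) ` units)"
      by (rule inj_on_lvl_img_cosets[OF assms m]) simp
    have "lvl_img m ` (\<lambda>M. lmul l M ` G) ` units \<subseteq> Pow (lvl_img m (Matl l))"
      unfolding lvl_img_def using units_lmul units_Matl GU by auto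
    then show "finite (lvl_img m ` (\<lambda>M. lmul l M ` G) ` units)"
      by (rule finite_subset) (simp add: finite_lvl_img)
  qed
qed

text \<open>At the level the indices agree, so reduction is injective on the finite set of cosets.
  The coset of \<open>M\<close> and \<open>G\<close> itself have the same reduction there, hence
  they coincide.\<close>

lemma congruent_to_lI_in_subgroup:
  assumes G: "open_subgroup l G units" and n: "level l units G \<le> n"
    and M: "M \<in> units" "M n = lI l n"
  shows "M \<in> G"
proof -
  have GU: "G \<subseteq> units" and I: "lI l \<in> G" using G unfolding open_subgroup_def by auto
  let ?k = "level l units G"
  have inj: "inj_on (lvl_img ?k) ((\<lambda>M. lmul l M ` G) ` units)"
    using finite_cosets[OF G] level_attained(2)[OF G]
    unfolding index_n_units index_l_units by (simp add: eq_card_imp_inj_on)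
  have Mk: "M ?k = lI l ?k" using M n Matl_red[of _ l ?k n] units_Matl lI_Matl by metis
  have "lvl_img ?k (lmul l M ` G) = lvl_img ?k (lmul l (lI l) ` G)"
    unfolding lvl_img_def image_image lmul_def Mk ..
  then have "lmul l M ` G = lmul l (lI l) ` G"
    using inj M(1) lI_units unfolding inj_on_def by blast
  then have "lmul l M (lI l) \<in> lmul l (lI l) ` G" using I by blast
  then show ?thesis using lmul_lI_left lmul_lI_right units_Matl M(1) GU by force
qed

lemma congruent_in_subgroup:
  assumes G: "open_subgroup l G units" and n: "level l units G \<le> n"
    and "M \<in> G" "N \<in> units" "M n = N n"
  shows "N \<in> G"
proof -
  have GU: "G \<subseteq> units" and mul: "\<And>M N. M \<in> G \<Longrightarrow> N \<in> G \<Longrightarrow> lmul l M N \<in> G"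
    using G unfolding open_subgroup_def by auto
  obtain K where K: "K \<in> units" "N = lmul l M K" "K n = lI l n"
    using units_divide[of M N n] assms GU by blast
  then show ?thesis using congruent_to_lI_in_subgroup[OF G n] mul assms by blast
qed

end

section \<open>Cartan subgroups in an arbitrary basis\<close>

text \<open>Take for \<open>W\<close> the conjugate by \<open>P\<close> of multiplication by
  \<open>w\<close> in the standard basis. The relation \<open>lmul l P X = lmul l M P\<close> then
  says that \<open>X\<close> and \<open>M\<close> have the same coordinates.\<close>

lemma cartan_eq_units:
  assumes l: "prime l" and P: "P \<in> GL2 l" and td: "t \<in> Zl l" "d \<in> Zl l"
  obtains W where "quad_order l W" "cartan l t d P = quad_order.units l W"
proof -
  obtain Q where Q: "Q \<in> Matl l" "lmul l P Q = lI l" "lmul l Q P = lI l"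
    using GL2_inverse[OF l P] .
  have PQ: "red (int l ^ n) (mmul (P n) (Q n)) = red (int l ^ n) mI"
    and QP: "red (int l ^ n) (mmul (Q n) (P n)) = red (int l ^ n) mI" for n
    using Q(2,3) unfolding lmul_def lI_def by meson+
  \<comment> \<open>The companion matrix of \<open>w^2 - t w + d\<close>, that is, multiplication by
    \<open>w\<close> in the basis \<open>(1, w)\<close>.\<close>
  define S :: "nat \<Rightarrow> mat2" where "S n = (0, - d n, 1, t n)" for n
  have std: "(x, - d n * y, y, x + t n * y) = mlin x y (S n)" for x y n
    by (simp add: mlin_def S_def mult.commute)
  have co: "coherent_mat l S" unfolding S_def coherent_mat_tuple
    using td by (auto intro!: coherent_intros simp: Zl_coherent)
  have coP: "coherent_mat l P" and coQ: "coherent_mat l Q"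
    using P Q by (simp_all add: Matl_iff GL2_def)
  define W where "W n = red (int l ^ n) (mmul (P n) (mmul (S n) (Q n)))" for n
  have WM: "W \<in> Matl l" unfolding W_def
    by (intro coherent_red_Matl coherent_mat_mmul co coP coQ)
  have "red (int l ^ n) (mmul (W n) (P n)) = red (int l ^ n) (mmul (mmul (P n) (S n)) (mmul (Q n) (P n)))" for n
    unfolding W_def red_mmul_red by (simp add: mmul_assoc)
  also have "\<dots> n = red (int l ^ n) (mmul (mmul (P n) (S n)) mI)" for n
    by (rule red_mmul_cong[OF refl QP])
  finally have intertwine: "red (int l ^ n) (mmul (P n) (S n)) = red (int l ^ n) (mmul (W n) (P n))" for n
    by simp
  have PX: "red (int l ^ n) (mmul (P n) (mlin x y (S n))) = red (int l ^ n) (mmul (mlin x y (W n)) (P n))" for n x y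
    by (rule mlin_intertwine[OF intertwine])
  have cancel_right: "red (int l ^ n) A = red (int l ^ n) B"
    if "red (int l ^ n) (mmul A (P n)) = red (int l ^ n) (mmul B (P n))" for A B n
  proof -
    have "red (int l ^ n) (mmul A (mmul (P n) (Q n))) = red (int l ^ n) (mmul B (mmul (P n) (Q n)))"
      using red_mmul_cong[OF that, of "Q n" "Q n"] by (simp add: mmul_assoc)
    then show ?thesis using red_mmul_cong[OF refl PQ] by (metis mmul_mI(2))
  qed
  interpret quad_order l W
  proof
    fix k x y assume "red (int l ^ k) (mlin x y (W k)) = (0, 0, 0, 0)"
    then have "red (int l ^ k) (mlin x y (W k)) = red (int l ^ k) (0, 0, 0, 0)" by (simp add: red_def)
    then have "red (int l ^ k) (mmul (mlin x y (W k)) (P k)) = red (int l ^ k) (mmul (0, 0, 0, 0) (P k))"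
      by (rule red_mmul_cong) simp
    then have "red (int l ^ k) (mmul (P k) (mlin x y (S k))) = red (int l ^ k) (0, 0, 0, 0)"
      unfolding PX by (simp add: mmul_def split: prod.split)
    then have "red (int l ^ k) (mmul (Q k) (mmul (P k) (mlin x y (S k)))) = red (int l ^ k) (mmul (Q k) (0, 0, 0, 0))"
      by (intro red_mmul_cong) simp_all
    then have "red (int l ^ k) (mlin x y (S k)) = red (int l ^ k) (0, 0, 0, 0)"
      using red_mmul_cong[OF QP refl]
      by (simp add: mmul_assoc[symmetric]) (simp add: mmul_def split: prod.split)
    \<comment> \<open>The first column of \<open>mlin x y (S k)\<close> consists of \<open>x\<close>
      and \<open>y\<close>.\<close>
    then show "int l ^ k dvd x \<and> int l ^ k dvd y"
      unfolding S_def mlin_def by (simp add: red_eq_iff)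
  qed (use l WM in auto)
  have "cartan l t d P = units"
  proof (rule subset_antisym; rule subsetI)
    fix M assume "M \<in> cartan l t d P"
    then obtain X x y where M: "M \<in> GL2 l" and PX_MP: "lmul l P X = lmul l M P" and xy: "x \<in> Zl l" "y \<in> Zl l"
      and X: "\<And>n. X n = red (int l ^ n) (mlin (x n) (y n) (S n))"
      unfolding cartan_def cartan_std_def std by blast
    have "M n = red (int l ^ n) (mlin (x n) (y n) (W n))" for n
    proof -
      have "red (int l ^ n) (mmul (M n) (P n)) = red (int l ^ n) (mmul (mlin (x n) (y n) (W n)) (P n))"
        using fun_cong[OF PX_MP, of n] X PX unfolding lmul_def by simp
      then show ?thesis using cancel_right Matl_red_self[OF GL2_Matl[OF M]] by metis
    qed
    then show "M \<in> units" using M xy unfolding units_def by blast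
  next
    fix M assume M: "M \<in> units"
    then obtain x y where xy: "x \<in> Zl l" "y \<in> Zl l" and Mxy: "\<And>n. M n = red (int l ^ n) (mlin (x n) (y n) (W n))"
      unfolding units_def by blast
    define X where "X n = red (int l ^ n) (mlin (x n) (y n) (S n))" for n
    have PX_MP: "lmul l P X = lmul l M P"
      unfolding lmul_def X_def Mxy by (simp add: PX)
    have "X \<in> Matl l" unfolding X_def
      by (intro coherent_red_Matl coherent_mlin co) (use xy in \<open>simp_all add: Zl_coherent\<close>)
    \<comment> \<open>\<open>P X = M P\<close> is invertible, hence so is its factor
      \<open>X\<close>.\<close>
    then have "X \<in> GL2 l" using GL2_factor(2) PX_MP GL2_lmul l P units_GL2[OF M] GL2_Matl by metis
    then show "M \<in> cartan l t d P"
      unfolding cartan_def cartan_std_def std using PX_MP xy X_def units_GL2[OF M] by blast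
  qed
  then show ?thesis using that quad_order_axioms by blast
qed

section \<open>Fixed points on the torsion group and Smith normal form\<close>

definition mapply :: "mat2 \<Rightarrow> int \<times> int \<Rightarrow> int \<times> int" where
  "mapply A z = (case A of (a, b, c, d) \<Rightarrow> (a * fst z + b * snd z, c * fst z + d * snd z))"

lemma mapply_cong_vec: "cong2 k z z' \<Longrightarrow> cong2 k (mapply A z) (mapply A z')"
  by (cases A; cases z; cases z')
    (auto simp: mapply_def mod2_def mod2_eq_iff[symmetric] intro!: mod_add_cong mod_mult_cong)

text \<open>The point \<open>z / l ^ K\<close> of the torsion group. Writing points this way
  replaces rational arithmetic by congruences modulo \<open>l ^ K\<close>.\<close>

definition tors :: "nat \<Rightarrow> nat \<Rightarrow> int \<times> int \<Rightarrow> rat \<times> rat" where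
  "tors l K z = (frac (of_int (fst z) / of_nat l ^ K), frac (of_int (snd z) / of_nat l ^ K))"

lemma frac_eq_frac_iff: "frac x = frac y \<longleftrightarrow> x - y \<in> \<int>"
proof
  assume "frac x = frac y"
  then have "x - y = of_int (\<lfloor>x\<rfloor> - \<lfloor>y\<rfloor>)" by (simp add: frac_def algebra_simps)
  then show "x - y \<in> \<int>" by (metis Ints_of_int)
next
  assume "x - y \<in> \<int>"
  then obtain k where "x = y + of_int k" by (metis Ints_cases diff_add_cancel add.commute)
  then show "frac x = frac y" by (simp add: frac_def)
qed

lemma of_int_divide_power_Ints_iff:
  assumes "0 < l"
  shows "(of_int z / of_nat l ^ K :: rat) \<in> \<int> \<longleftrightarrow> int l ^ K dvd z"
proof
  assume "(of_int z / of_nat l ^ K :: rat) \<in> \<int>"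
  then obtain k where "(of_int z / of_nat l ^ K :: rat) = of_int k" by (auto elim: Ints_cases)
  then have "(of_int z :: rat) = of_int (k * int l ^ K)" using assms by (simp add: field_simps)
  then show "int l ^ K dvd z" by (simp only: of_int_eq_iff dvd_triv_right)
next
  assume "int l ^ K dvd z"
  then show "(of_int z / of_nat l ^ K :: rat) \<in> \<int>" using assms by auto
qed

lemma tors_eq_iff:
  assumes "0 < l"
  shows "tors l K z = tors l K z' \<longleftrightarrow> cong2 (int l ^ K) z' z"
  unfolding tors_def cong2_def prod.inject frac_eq_frac_iff
  using of_int_divide_power_Ints_iff[OF assms, of "fst z - fst z'" K]
    of_int_divide_power_Ints_iff[OF assms, of "snd z - snd z'" K]
  by (simp add: diff_divide_distrib)

lemma tors_scale:
  assumes "0 < l"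
  shows "tors l (j + K) (int l ^ j * u, int l ^ j * w) = tors l K (u, w)"
  using assms by (simp add: tors_def power_add)

lemma tors_add:
  "mult (QZ2 l) (tors l K z) (tors l K z') = tors l K (fst z + fst z', snd z + snd z')"
  by (simp add: QZ2_def tors_def add_divide_distrib)

lemma tors_carrier:
  assumes "0 < l"
  shows "tors l K z \<in> carrier (QZ2 l)"
proof -
  have "frac (of_int u / of_nat l ^ K :: rat) \<in> QZl l" for u
  proof -
    have "of_nat l ^ K * frac (of_int u / of_nat l ^ K :: rat) = of_int (u - int l ^ K * \<lfloor>of_int u / of_nat l ^ K :: rat\<rfloor>)"
      using assms by (simp add: frac_def algebra_simps)
    then have "of_nat l ^ K * frac (of_int u / of_nat l ^ K :: rat) \<in> \<int>" by (metis Ints_of_int)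
    then show ?thesis unfolding QZl_def using frac_lt_1 by auto
  qed
  then show ?thesis by (simp add: QZ2_def tors_def)
qed

text \<open>Denominators can always be enlarged; the bound \<open>K0\<close> secures whatever
  precision of the matrix an argument requires.\<close>

lemma torsE:
  assumes "0 < l" "v \<in> carrier (QZ2 l)"
  obtains K z where "K0 \<le> K" "v = tors l K z"
proof -
  have ex: "\<exists>m. \<forall>K\<ge>m. \<exists>u. q = of_int u / of_nat l ^ K" if q: "q \<in> QZl l" for q
  proof -
    obtain m where "of_nat l ^ m * q \<in> \<int>" using q by (auto simp: QZl_def)
    then obtain u where u: "of_nat l ^ m * q = of_int u" by (auto elim: Ints_cases)
    have "q = of_int (int l ^ (K - m) * u) / of_nat l ^ K" if "m \<le> K" for K
    proof -
      have "(of_nat l :: rat) ^ K = of_nat l ^ (K - m) * of_nat l ^ m" using that by (simp flip: power_add)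
      then show ?thesis using u[symmetric] assms(1) by simp
    qed
    then show ?thesis by blast
  qed
  have v: "fst v \<in> QZl l" "snd v \<in> QZl l" using assms(2) by (auto simp: QZ2_def)
  obtain m1 where m1: "\<And>K. K \<ge> m1 \<Longrightarrow> \<exists>u. fst v = of_int u / of_nat l ^ K" using ex[OF v(1)] by blast
  obtain m2 where m2: "\<And>K. K \<ge> m2 \<Longrightarrow> \<exists>u. snd v = of_int u / of_nat l ^ K" using ex[OF v(2)] by blast
  define K where "K = max K0 (max m1 m2)"
  obtain u w where uw: "fst v = of_int u / of_nat l ^ K" "snd v = of_int w / of_nat l ^ K"
    using m1[of K] m2[of K] unfolding K_def by (meson max.cobounded1 max.cobounded2 order_trans)
  have "frac (fst v) = fst v" "frac (snd v) = snd v" using v by (auto simp: QZl_def frac_eq)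
  then have "v = tors l K (u, w)" using uw unfolding tors_def by (metis fst_conv prod.collapse snd_conv)
  then show ?thesis using that[of K] unfolding K_def by simp
qed

text \<open>The definition of \<open>act\<close> uses the least exponent \<open>m\<close> that
  clears denominators. Any larger \<open>K\<close> gives the same point, since \<open>M K\<close>
  and \<open>M m\<close> agree modulo \<open>l ^ m\<close> and the vector acquires the missing
  factor \<open>l ^ (K - m)\<close>.\<close>

lemma act_tors:
  assumes l: "0 < l" and M: "M \<in> Matl l"
  shows "act l M (tors l K z) = tors l K (mapply (M K) z)"
proof -
  define v where "v = tors l K z"
  have vc: "v \<in> carrier (QZ2 l)" unfolding v_def by (rule tors_carrier[OF l])
  define P where "P m \<longleftrightarrow> of_nat l ^ m * fst v \<in> \<int> \<and> of_nat l ^ m * snd v \<in> \<int>" for m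
  have "of_nat l ^ K * frac (of_int u / of_nat l ^ K :: rat) \<in> \<int>" for u
  proof -
    have "of_nat l ^ K * frac (of_int u / of_nat l ^ K :: rat) = of_int (u - int l ^ K * \<lfloor>of_int u / of_nat l ^ K :: rat\<rfloor>)"
      using l by (simp add: frac_def algebra_simps)
    then show ?thesis by (metis Ints_of_int)
  qed
  then have PK: "P K" unfolding P_def v_def tors_def by simp
  define m where "m = (LEAST m. P m)"
  have mK: "m \<le> K" unfolding m_def by (rule Least_le[of P, OF PK])
  have Pm: "P m" unfolding m_def by (rule LeastI[of P, OF PK])
  define u0 where "u0 = \<lfloor>of_nat l ^ m * fst v\<rfloor>"
  define w0 where "w0 = \<lfloor>of_nat l ^ m * snd v\<rfloor>"
  have "of_int u0 = of_nat l ^ m * fst v" "of_int w0 = of_nat l ^ m * snd v"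
    using Pm unfolding P_def u0_def w0_def by (auto elim!: Ints_cases)
  then have uw: "fst v = of_int u0 / of_nat l ^ m" "snd v = of_int w0 / of_nat l ^ m"
    using l by (simp_all add: field_simps)
  have "frac (fst v) = fst v" "frac (snd v) = snd v" using vc by (auto simp: QZ2_def QZl_def frac_eq)
  then have v0: "v = tors l m (u0, w0)" using uw unfolding tors_def by (metis fst_conv prod.collapse snd_conv)
  have act: "act l M v = tors l m (mapply (M m) (u0, w0))"
    unfolding act_def Let_def P_def[symmetric] m_def[symmetric] u0_def[symmetric] w0_def[symmetric] tors_def mapply_def
    by (simp split: prod.split)
  define j where "j = K - m"
  have K: "K = j + m" using mK unfolding j_def by simp
  define z0 where "z0 = (int l ^ j * u0, int l ^ j * w0)"
  have "v = tors l K z0" unfolding v0 z0_def K by (rule tors_scale[OF l, symmetric])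
  then have z0: "cong2 (int l ^ K) z0 z" unfolding v_def by (simp add: tors_eq_iff[OF l])
  obtain a b c d where Mm: "M m = (a, b, c, d)" using prod_cases4 .
  obtain a' b' c' d' where MK: "M K = (a', b', c', d')" using prod_cases4 .
  have "red (int l ^ m) (M K) = red (int l ^ m) (M m)"
    using Matl_red[OF M] mK by simp
  then have d: "int l ^ m dvd a' - a" "int l ^ m dvd b' - b" "int l ^ m dvd c' - c" "int l ^ m dvd d' - d"
    unfolding Mm MK red_eq_iff by auto
  have "mapply (M m) (u0, w0) = (a * u0 + b * w0, c * u0 + d * w0)" unfolding Mm mapply_def by simp
  then have "tors l m (mapply (M m) (u0, w0)) = tors l K (mapply (M m) z0)"
    using tors_scale[OF l, of j m "a * u0 + b * w0" "c * u0 + d * w0"]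
    unfolding K z0_def Mm mapply_def by (simp add: algebra_simps)
  also have "\<dots> = tors l K (mapply (M K) z0)"
  proof -
    have "int l ^ m dvd (a' - a) * u0 + (b' - b) * w0" "int l ^ m dvd (c' - c) * u0 + (d' - d) * w0"
      using d by (auto intro: dvd_add)
    then have "int l ^ K dvd int l ^ j * ((a' - a) * u0 + (b' - b) * w0)"
      "int l ^ K dvd int l ^ j * ((c' - c) * u0 + (d' - d) * w0)"
      unfolding K power_add by (auto intro: mult_dvd_mono)
    moreover have "fst (mapply (M K) z0) - fst (mapply (M m) z0) = int l ^ j * ((a' - a) * u0 + (b' - b) * w0)"
      "snd (mapply (M K) z0) - snd (mapply (M m) z0) = int l ^ j * ((c' - c) * u0 + (d' - d) * w0)"
      unfolding MK Mm z0_def mapply_def by (simp_all add: algebra_simps)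
    ultimately show ?thesis using cong2_sym unfolding tors_eq_iff[OF l] by (simp add: cong2_def dvd_diff_commute)
  qed
  also have "\<dots> = tors l K (mapply (M K) z)"
    unfolding tors_eq_iff[OF l] by (rule mapply_cong_vec[OF cong2_sym[OF z0]])
  finally show ?thesis using act unfolding v_def by simp
qed

lemma tors_fixker_iff:
  assumes "0 < l" "M \<in> Matl l"
  shows "tors l K z \<in> fixker l M \<longleftrightarrow> cong2 (int l ^ K) z (mapply (M K) z)"
  using tors_carrier[OF assms(1)] by (simp add: fixker_def act_tors[OF assms] tors_eq_iff[OF assms(1)])

section \<open>Smith type and the fixed-point condition\<close>

text \<open>Over the \<open>p\<close>-adic integers this says that \<open>N - I\<close> has
  elementary divisors \<open>p ^ a\<close> and \<open>p ^ (a + b)\<close>.\<close>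

definition smith_type :: "int \<Rightarrow> nat \<Rightarrow> nat \<Rightarrow> mat2 \<Rightarrow> bool" where
  "smith_type p a b N \<longleftrightarrow> (\<exists>A. N = mlin 1 (p ^ a) A \<and> red p A \<noteq> red p (0, 0, 0, 0) \<and> exact_val p b (mdet A))"

text \<open>Dividing \<open>N - I\<close> by \<open>p ^ a\<close> loses \<open>a\<close> digits, so
  precision \<open>a + b + 1\<close> leaves the \<open>b + 1\<close> digits of \<open>A\<close> that
  decide whether its determinant has valuation \<open>b\<close>.\<close>

lemma smith_type_congE:
  assumes "red (p ^ Suc (a + b)) N = red (p ^ Suc (a + b)) (mlin 1 (p ^ a) A)"
  obtains B where "N = mlin 1 (p ^ a) B" "red (p ^ Suc b) B = red (p ^ Suc b) A"
proof -
  obtain q r s t where A: "A = (q, r, s, t)" using prod_cases4 .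
  obtain q' r' s' t' where N: "N = (q', r', s', t')" using prod_cases4 .
  have d: "p ^ Suc (a + b) dvd q' - (1 + p ^ a * q)" "p ^ Suc (a + b) dvd r' - p ^ a * r"
    "p ^ Suc (a + b) dvd s' - p ^ a * s" "p ^ Suc (a + b) dvd t' - (1 + p ^ a * t)"
    using assms unfolding A N mlin_def prod.case red_eq_iff by auto
  have *: "p ^ Suc (a + b) = p ^ a * p ^ Suc b" by (simp add: power_add)
  obtain e f g h where eqs: "q' = 1 + p ^ a * q + p ^ Suc (a + b) * e" "r' = p ^ a * r + p ^ Suc (a + b) * f"
    "s' = p ^ a * s + p ^ Suc (a + b) * g" "t' = 1 + p ^ a * t + p ^ Suc (a + b) * h"
    using d by (elim dvdE) (metis add.commute diff_add_cancel)
  let ?B = "(q + p ^ Suc b * e, r + p ^ Suc b * f, s + p ^ Suc b * g, t + p ^ Suc b * h)"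
  have "N = mlin 1 (p ^ a) ?B"
    unfolding N eqs * mlin_def by (simp add: algebra_simps)
  moreover have "red (p ^ Suc b) ?B = red (p ^ Suc b) A"
    unfolding A red_eq_iff by simp
  ultimately show ?thesis using that by blast
qed

lemma smith_type_cong:
  assumes "red (p ^ Suc (a + b)) N = red (p ^ Suc (a + b)) N'" "smith_type p a b N'"
  shows "smith_type p a b N"
proof -
  obtain A where A: "N' = mlin 1 (p ^ a) A" "red p A \<noteq> red p (0, 0, 0, 0)" "exact_val p b (mdet A)"
    using assms(2) unfolding smith_type_def by blast
  obtain B where B: "N = mlin 1 (p ^ a) B" "red (p ^ Suc b) B = red (p ^ Suc b) A"
    using smith_type_congE assms(1) A(1) by metis
  have "red p B = red p A" using B(2) by (rule red_cong_dvd[rotated]) simp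
  moreover have "exact_val p b (mdet B)"
    using exact_val_cong A(3) mdet_cong[OF B(2)] by (metis mod_eq_dvd_iff)
  ultimately show ?thesis using A B unfolding smith_type_def by metis
qed

text \<open>The coordinates of the kernel with respect to \<open>e\<close>, \<open>f\<close> are independent of each other, which makes
  its structure visible.\<close>

lemma kernel_vector:
  assumes "prime p" "red p A \<noteq> red p (0, 0, 0, 0)"
  obtains e f :: "int \<times> int"
  where "\<not> p dvd fst e * snd f - snd e * fst f" "cong2 (mdet A) (0, 0) (mapply A f)"
proof -
  obtain q r s t where A: "A = (q, r, s, t)" using prod_cases4 .
  consider "\<not> p dvd q" | "\<not> p dvd r" | "\<not> p dvd s" | "\<not> p dvd t"
    using assms(2) unfolding A red_eq_iff by auto
  then show ?thesis
  proof cases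
    \<comment> \<open>In all four cases \<open>f\<close> is a column of the adjugate, so
      \<open>A f\<close> has the determinant as one entry and 0 as the other. The standard vector
      \<open>e\<close> makes the determinant of \<open>e\<close>, \<open>f\<close> the given unit
      entry up to sign.\<close>
    case 1 show ?thesis
      by (rule that[of "(1, 0)" "(- r, q)"]) (use 1 in \<open>simp_all add: A mapply_def cong2_def mdet_def algebra_simps\<close>)
  next
    case 2 show ?thesis
      by (rule that[of "(0, 1)" "(- r, q)"]) (use 2 in \<open>simp_all add: A mapply_def cong2_def mdet_def algebra_simps\<close>)
  next
    case 3 show ?thesis
      by (rule that[of "(1, 0)" "(t, - s)"]) (use 3 in \<open>simp_all add: A mapply_def cong2_def mdet_def algebra_simps\<close>)
  next
    case 4 show ?thesis
      by (rule that[of "(0, 1)" "(t, - s)"]) (use 4 in \<open>simp_all add: A mapply_def cong2_def mdet_def algebra_simps\<close>)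
  qed
qed

text \<open>Cramer's rule recovers \<open>i\<close> and \<open>j\<close> up to the determinant,
  which is prime to \<open>p\<close>.\<close>

lemma unimodular_dvd_iff:
  fixes p :: int
  assumes "prime p" "\<not> p dvd fst e * snd f - snd e * fst f"
  shows "p ^ k dvd i * fst e + j * fst f \<and> p ^ k dvd i * snd e + j * snd f \<longleftrightarrow> p ^ k dvd i \<and> p ^ k dvd j"
    (is "?X \<and> ?Y \<longleftrightarrow> _")
proof
  assume *: "?X \<and> ?Y"
  have "p ^ k dvd (i * fst e + j * fst f) * snd f - (i * snd e + j * snd f) * fst f"
    "p ^ k dvd (i * snd e + j * snd f) * fst e - (i * fst e + j * fst f) * snd e"
    using * by (meson dvd_diff dvd_mult2)+
  moreover have "(i * fst e + j * fst f) * snd f - (i * snd e + j * snd f) * fst f = (fst e * snd f - snd e * fst f) * i"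
    "(i * snd e + j * snd f) * fst e - (i * fst e + j * fst f) * snd e = (fst e * snd f - snd e * fst f) * j"
    by (simp_all add: algebra_simps)
  ultimately show "p ^ k dvd i \<and> p ^ k dvd j"
    using prime_power_dvd_unit_mult_iff[OF assms] by metis
qed auto

definition comb :: "int \<times> int \<Rightarrow> int \<times> int \<Rightarrow> int \<Rightarrow> int \<Rightarrow> int \<times> int" where
  "comb e f i j = (i * fst e + j * fst f, i * snd e + j * snd f)"

lemma comb_cong_iff:
  assumes "prime p" "\<not> p dvd fst e * snd f - snd e * fst f"
  shows "cong2 (p ^ k) (comb e f i j) (comb e f i' j') \<longleftrightarrow> p ^ k dvd i' - i \<and> p ^ k dvd j' - j"
proof -
  have "fst (comb e f i' j') - fst (comb e f i j) = (i' - i) * fst e + (j' - j) * fst f"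
    "snd (comb e f i' j') - snd (comb e f i j) = (i' - i) * snd e + (j' - j) * snd f"
    unfolding comb_def by (simp_all add: algebra_simps)
  then show ?thesis unfolding cong2_def using unimodular_dvd_iff[OF assms] by simp
qed

lemma mapply_comb: "mapply A (comb e f i j) = comb (mapply A e) (mapply A f) i j"
  by (cases A) (simp add: mapply_def comb_def algebra_simps)

lemma mapply_mlin_1:
  "fst (mapply (mlin 1 y A) z) - fst z = y * fst (mapply A z)"
  "snd (mapply (mlin 1 y A) z) - snd z = y * snd (mapply A z)"
  by (cases A; simp add: mapply_def mlin_def algebra_simps)+

lemma mapply_wedge:
  "fst (mapply A e) * snd (mapply A f) - snd (mapply A e) * fst (mapply A f)
   = mdet A * (fst e * snd f - snd e * fst f)"
  by (cases A) (simp add: mapply_def mdet_def algebra_simps)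

lemma mapply_cong_mat: "red k A = red k B \<Longrightarrow> cong2 k (mapply A z) (mapply B z)"
  by (cases A; cases B)
    (auto simp: mapply_def red_def mod2_def mod2_eq_iff[symmetric] intro!: mod_add_cong mod_mult_cong)

text \<open>The determinant of \<open>A e\<close>, \<open>A f\<close> has valuation exactly
  \<open>b\<close>, and \<open>A f\<close> is divisible by \<open>p ^ b\<close>. After removing that
  factor the two images have determinant prime to \<open>p\<close>, so the conditions on
  \<open>i\<close> and \<open>j\<close> separate.\<close>

lemma fixed_comb_iff:
  fixes p :: int
  assumes p: "prime p" and ef: "\<not> p dvd fst e * snd f - snd e * fst f"
    and f: "cong2 (p ^ b) (0, 0) (mapply A f)" and A: "exact_val p b (mdet A)"
    and K: "a + b \<le> K"
  shows "cong2 (p ^ K) (comb e f i j) (mapply (mlin 1 (p ^ a) A) (comb e f i j)) \<longleftrightarrow>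
    p ^ (K - a) dvd i \<and> p ^ (K - a - b) dvd j"
proof -
  obtain h1 h2 where h: "mapply A f = (p ^ b * h1, p ^ b * h2)"
    using f unfolding cong2_def by (metis diff_zero dvdE fst_conv snd_conv prod.collapse)
  let ?e = "mapply A e"
  have p0: "p \<noteq> 0" using p by auto
  then have nz: "p ^ n \<noteq> 0" for n using p by auto
  have "p ^ b * (fst ?e * h2 - snd ?e * h1) = mdet A * (fst e * snd f - snd e * fst f)"
    using mapply_wedge[of A e f] unfolding h by (simp add: algebra_simps)
  then have "\<not> p ^ b * p dvd p ^ b * (fst ?e * h2 - snd ?e * h1)"
    using A exact_val_unit_mult[OF p ef, of b "mdet A"] unfolding exact_val_def by (simp add: mult.commute)
  then have wedge: "\<not> p dvd fst ?e * snd (h1, h2) - snd ?e * fst (h1, h2)" using nz by simp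
  have split: "p ^ K = p ^ a * p ^ (K - a)" "p ^ (K - a) = p ^ b * p ^ (K - a - b)"
    using K by (simp_all flip: power_add)
  have "cong2 (p ^ K) (comb e f i j) (mapply (mlin 1 (p ^ a) A) (comb e f i j)) \<longleftrightarrow>
     p ^ (K - a) dvd i * fst ?e + (p ^ b * j) * fst (h1, h2) \<and> p ^ (K - a) dvd i * snd ?e + (p ^ b * j) * snd (h1, h2)"
    unfolding cong2_def mapply_mlin_1 split(1) unfolding mapply_comb h using p0
    by (simp add: comb_def mult_ac)
  also have "\<dots> \<longleftrightarrow> p ^ (K - a) dvd i \<and> p ^ (K - a) dvd p ^ b * j"
    by (rule unimodular_dvd_iff[OF p wedge])
  also have "p ^ (K - a) dvd p ^ b * j \<longleftrightarrow> p ^ (K - a - b) dvd j"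
    unfolding split(2) using p0 by simp
  finally show ?thesis .
qed

section \<open>The kernel as an abelian group\<close>

abbreviation cyc2 :: "nat \<Rightarrow> nat \<Rightarrow> nat \<Rightarrow> (int \<times> int) monoid" where
  "cyc2 l a b \<equiv> DirProd (integer_mod_group (l ^ a)) (integer_mod_group (l ^ (a + b)))"

abbreviation fixgrp :: "nat \<Rightarrow> (nat \<Rightarrow> mat2) \<Rightarrow> (rat \<times> rat) monoid" where
  "fixgrp l M \<equiv> (QZ2 l)\<lparr>carrier := fixker l M\<rparr>"

lemma group_cyc2: "group (cyc2 l a b)"
  by (intro DirProd_group group_integer_mod_group)

text \<open>In the coordinates along \<open>e\<close> and \<open>f\<close> the fixed-point condition
  separates, and each of the two directions contributes one cyclic factor.\<close>

lemma smith_type_imp_iso: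
  assumes l: "prime l" and M: "M \<in> Matl l" and S: "smith_type (int l) a b (M (Suc (a + b)))"
  shows "cyc2 l a b \<cong> fixgrp l M"
proof -
  let ?L = "int l" and ?K = "Suc (a + b)"
  have l0: "0 < l" using l prime_gt_0_nat by blast
  have L: "prime ?L" using l by simp
  have nz: "?L ^ n \<noteq> 0" for n using l0 by simp
  obtain A0 where A0: "M ?K = mlin 1 (?L ^ a) A0" "red ?L A0 \<noteq> red ?L (0, 0, 0, 0)" "exact_val ?L b (mdet A0)"
    using S unfolding smith_type_def by blast
  obtain e f where ef: "\<not> ?L dvd fst e * snd f - snd e * fst f" and f0: "cong2 (mdet A0) (0, 0) (mapply A0 f)"
    using kernel_vector[OF L A0(2)] .
  have fix_iff: "tors l K (comb e f i j) \<in> fixker l M \<longleftrightarrow> ?L ^ (K - a) dvd i \<and> ?L ^ (K - a - b) dvd j"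
    if K: "?K \<le> K" for K i j
  proof -
    have "red (?L ^ ?K) (M K) = red (?L ^ ?K) (mlin 1 (?L ^ a) A0)"
      using Matl_red[OF M K] Matl_red_self[OF M, of ?K] A0(1) by simp
    \<comment> \<open>At higher precision \<open>A0\<close> is replaced by some \<open>A\<close>
      congruent to it modulo \<open>l ^ (b + 1)\<close>. This is close enough for the same
      \<open>e\<close> and \<open>f\<close> to serve for every \<open>K\<close>.\<close>
    then obtain A where A: "M K = mlin 1 (?L ^ a) A" "red (?L ^ Suc b) A = red (?L ^ Suc b) A0"
      using smith_type_congE by blast
    have "exact_val ?L b (mdet A)"
      using exact_val_cong A0(3) mdet_cong[OF A(2)] by (metis mod_eq_dvd_iff)
    moreover have "cong2 (?L ^ b) (0, 0) (mapply A0 f)"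
      using f0 A0(3) unfolding cong2_def exact_val_def by (meson dvd_trans)
    moreover have "red (?L ^ b) A0 = red (?L ^ b) A"
      using A(2) by (intro red_cong_dvd[of "?L ^ b" "?L ^ Suc b"]) (simp_all add: le_imp_power_dvd)
    ultimately show ?thesis
      unfolding tors_fixker_iff[OF l0 M] A(1)
      using fixed_comb_iff[OF L ef] cong2_trans mapply_cong_mat K by (meson Suc_leD)
  qed
  \<comment> \<open>This is \<open>i e / l ^ a + j f / l ^ (a + b)\<close> for
    \<open>x = (i, j)\<close>, written over the common denominator
    \<open>l ^ (a + b + 1)\<close>.\<close>
  define \<phi> where "\<phi> x = tors l ?K (comb e f (?L ^ Suc b * fst x) (?L * snd x))" for x
  have eq_iff: "\<phi> x = \<phi> y \<longleftrightarrow> ?L ^ a dvd fst x - fst y \<and> ?L ^ (a + b) dvd snd x - snd y" for x y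
  proof -
    have "?L ^ ?K dvd ?L ^ Suc b * fst x - ?L ^ Suc b * fst y \<longleftrightarrow> ?L ^ a dvd fst x - fst y"
    proof -
      have "?L ^ ?K = ?L ^ Suc b * ?L ^ a" by (simp add: power_add)
      then show ?thesis using nz[of "Suc b"] by (simp only: right_diff_distrib[symmetric] dvd_mult_cancel_left) simp
    qed
    moreover have "?L ^ ?K dvd ?L * snd x - ?L * snd y \<longleftrightarrow> ?L ^ (a + b) dvd snd x - snd y"
      using l0 by (simp only: right_diff_distrib[symmetric] dvd_mult_cancel_left power_Suc) simp
    ultimately show ?thesis unfolding \<phi>_def tors_eq_iff[OF l0] comb_cong_iff[OF L ef] by simp
  qed
  have fixed: "\<phi> x \<in> fixker l M" for x
    unfolding \<phi>_def fix_iff[OF le_refl] by (simp add: Suc_diff_le)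
  have "\<phi> \<in> hom (cyc2 l a b) (fixgrp l M)"
  proof (rule homI)
    fix x y
    let ?xy = "x \<otimes>\<^bsub>cyc2 l a b\<^esub> y"
    have "mult (fixgrp l M) (\<phi> x) (\<phi> y) = \<phi> (fst x + fst y, snd x + snd y)"
      unfolding \<phi>_def by (simp add: tors_add) (simp add: comb_def algebra_simps)
    also have "\<dots> = \<phi> ?xy"
      unfolding eq_iff mult_DirProd' by (simp add: mod_eq_dvd_iff[symmetric])
    finally show "\<phi> ?xy = mult (fixgrp l M) (\<phi> x) (\<phi> y)" ..
  qed (simp add: fixed)
  moreover have "bij_betw \<phi> (carrier (cyc2 l a b)) (fixker l M)"
    unfolding bij_betw_def
  proof
    show "inj_on \<phi> (carrier (cyc2 l a b))"
    proof (rule inj_onI)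
      fix x y assume xy: "x \<in> carrier (cyc2 l a b)" "y \<in> carrier (cyc2 l a b)" "\<phi> x = \<phi> y"
      then have "fst x mod ?L ^ a = fst y mod ?L ^ a" "snd x mod ?L ^ (a + b) = snd y mod ?L ^ (a + b)"
        unfolding eq_iff mod_eq_dvd_iff by simp_all
      then show "x = y" using xy(1,2) l0
        by (auto simp: carrier_integer_mod_group mod_pos_pos_trivial)
    qed
    show "\<phi> ` carrier (cyc2 l a b) = fixker l M"
    proof
      show "\<phi> ` carrier (cyc2 l a b) \<subseteq> fixker l M" using fixed by auto
      show "fixker l M \<subseteq> \<phi> ` carrier (cyc2 l a b)"
      proof
        fix v assume v: "v \<in> fixker l M"
        then have "v \<in> carrier (QZ2 l)" by (simp add: fixker_def)
        then obtain K z where K: "?K \<le> K" and vz: "v = tors l K z" using torsE[OF l0] by metis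
        obtain u where u: "?L ^ K dvd (fst e * snd f - snd e * fst f) * u - 1"
          using unit_mod_prime_power[OF L ef] .
        \<comment> \<open>Cramer's rule modulo \<open>l ^ K\<close>: \<open>i0\<close> and
          \<open>j0\<close> are the coordinates of \<open>z\<close> along \<open>e\<close> and
          \<open>f\<close>.\<close>
        define i0 where "i0 = u * (fst z * snd f - snd z * fst f)"
        define j0 where "j0 = u * (fst e * snd z - snd e * fst z)"
        have "fst (comb e f i0 j0) - fst z = ((fst e * snd f - snd e * fst f) * u - 1) * fst z"
          "snd (comb e f i0 j0) - snd z = ((fst e * snd f - snd e * fst f) * u - 1) * snd z"
          unfolding comb_def i0_def j0_def by (simp_all add: algebra_simps)
        then have "cong2 (?L ^ K) z (comb e f i0 j0)" using u unfolding cong2_def by simp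
        then have v0: "v = tors l K (comb e f i0 j0)"
          unfolding vz using tors_eq_iff[OF l0] cong2_sym by blast
        then have "?L ^ (K - a) dvd i0" "?L ^ (K - a - b) dvd j0" using v fix_iff[OF K] by auto
        then obtain i j where ij: "i0 = ?L ^ (K - a) * i" "j0 = ?L ^ (K - a - b) * j" by (auto elim!: dvdE)
        \<comment> \<open>Both coordinates share the factor \<open>l ^ J\<close>; cancelling it
          brings the denominator down to the one used in \<open>\<phi>\<close>.\<close>
        define J where "J = K - ?K"
        have J: "K = J + ?K" "K - a = J + Suc b" "K - a - b = J + 1" using K unfolding J_def by auto
        have "comb e f i0 j0 = (?L ^ J * fst (comb e f (?L ^ Suc b * i) (?L * j)), ?L ^ J * snd (comb e f (?L ^ Suc b * i) (?L * j)))"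
          unfolding comb_def ij J(2,3) power_add by (simp add: algebra_simps)
        then have "v = tors l (J + ?K) (?L ^ J * fst (comb e f (?L ^ Suc b * i) (?L * j)), ?L ^ J * snd (comb e f (?L ^ Suc b * i) (?L * j)))"
          using v0 J(1) by metis
        then have "v = \<phi> (i, j)" unfolding \<phi>_def tors_scale[OF l0] by simp
        also have "\<dots> = \<phi> (i mod ?L ^ a, j mod ?L ^ (a + b))"
          unfolding eq_iff by (simp add: mod_eq_dvd_iff[symmetric])
        finally show "v \<in> \<phi> ` carrier (cyc2 l a b)"
          using l0 by (auto simp: carrier_integer_mod_group)
      qed
    qed
  qed
  ultimately show ?thesis by (intro is_isoI[of \<phi>]) (simp add: iso_def)
qed

section \<open>Recovering the Smith type from the kernel\<close>

text \<open>The content of \<open>N - I\<close> gives \<open>a\<close> and the determinant of the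
  remaining factor gives \<open>b\<close>. If either valuation exhausts the precision
  \<open>K\<close>, a primitive vector is fixed modulo \<open>p ^ K\<close>.\<close>

lemma smith_type_or_fixed_vector:
  fixes p :: int
  assumes p: "prime p"
  obtains a b where "a + b < K" "smith_type p a b N"
  | z where "\<not> (p dvd fst z \<and> p dvd snd z)" "cong2 (p ^ K) z (mapply N z)"
proof -
  obtain q r s t where N: "N = (q, r, s, t)" using prod_cases4 .
  have nz: "p ^ n \<noteq> 0" for n using p by auto
  define Q where "Q k \<longleftrightarrow> p ^ k dvd q - 1 \<and> p ^ k dvd r \<and> p ^ k dvd s \<and> p ^ k dvd t - 1" for k
  show ?thesis
  proof (cases "Q K")
    case True
    show ?thesis by (rule that(2)[of "(1, 0)"])
      (use True p in \<open>auto simp: Q_def N cong2_def mapply_def dest: not_prime_unit\<close>)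
  next
    case False
    obtain a where a: "a < K" "Q a" "\<not> Q (Suc a)"
      using ex_least_nat_less[of "\<lambda>k. \<not> Q k" K] False by (auto simp: Q_def)
    obtain q' r' s' t' where A: "q = 1 + p ^ a * q'" "r = p ^ a * r'" "s = p ^ a * s'" "t = 1 + p ^ a * t'"
      using a(2) unfolding Q_def by (metis dvdE add.commute diff_add_cancel)
    define A where "A = (q', r', s', t')"
    have NA: "N = mlin 1 (p ^ a) A" unfolding N A A_def mlin_def by simp
    have prim: "red p A \<noteq> red p (0, 0, 0, 0)"
      using a(3) nz[of a] unfolding Q_def A A_def red_eq_iff by (auto simp: mult.commute[of p])
    show ?thesis
    proof (cases "p ^ (K - a) dvd mdet A")
      case True
      obtain e f where ef: "\<not> p dvd fst e * snd f - snd e * fst f" "cong2 (mdet A) (0, 0) (mapply A f)"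
        using kernel_vector[OF p prim] .
      have "p ^ K = p ^ a * p ^ (K - a)" using a(1) by (simp flip: power_add)
      then have "cong2 (p ^ K) f (mapply N f)"
        using ef(2) True unfolding NA cong2_def mapply_mlin_1 by (auto intro: mult_dvd_mono dvd_trans)
      moreover have "\<not> (p dvd fst f \<and> p dvd snd f)" using ef(1) by (auto intro: dvd_diff dvd_mult)
      ultimately show ?thesis using that(2) by blast
    next
      case False
      obtain b where "b < K - a" "p ^ b dvd mdet A" "\<not> p ^ Suc b dvd mdet A"
        using ex_least_nat_less[of "\<lambda>k. \<not> p ^ k dvd mdet A" "K - a"] False by auto
      then show ?thesis using that(1)[of a b] NA prim unfolding smith_type_def exact_val_def
        by (metis less_diff_conv add.commute)
    qed
  qed
qed

text \<open>The multiples of the point \<open>z / l ^ K\<close> are fixed, and primitivity of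
  \<open>z\<close> makes \<open>l ^ K\<close> of them distinct.\<close>

lemma card_fixker_ge:
  assumes l: "prime l" and M: "M \<in> Matl l" and z: "\<not> (int l dvd fst z \<and> int l dvd snd z)"
    and vec: "cong2 (int l ^ K) z (mapply (M K) z)" and fin: "finite (fixker l M)"
  shows "l ^ K \<le> card (fixker l M)"
proof -
  have l0: "0 < l" using l prime_gt_0_nat by blast
  have L: "prime (int l)" using l by simp
  define g where "g c = tors l K (c * fst z, c * snd z)" for c :: int
  have "g c \<in> fixker l M" for c
  proof -
    have "mapply (M K) (c * fst z, c * snd z) = (c * fst (mapply (M K) z), c * snd (mapply (M K) z))"
      by (cases "M K") (simp add: mapply_def algebra_simps)
    then show ?thesis using vec unfolding g_def tors_fixker_iff[OF l0 M]
      by (simp add: cong2_def right_diff_distrib[symmetric])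
  qed
  moreover have "inj_on g {0..<int l ^ K}"
  proof (rule inj_onI)
    fix c c' assume c: "c \<in> {0..<int l ^ K}" "c' \<in> {0..<int l ^ K}" "g c = g c'"
    then have "int l ^ K dvd fst z * (c - c')" "int l ^ K dvd snd z * (c - c')"
      unfolding g_def tors_eq_iff[OF l0] cong2_def by (simp_all add: algebra_simps)
    then have "int l ^ K dvd c - c'"
      using z prime_power_dvd_unit_mult_iff[OF L] by blast
    then have "c mod int l ^ K = c' mod int l ^ K" by (simp add: mod_eq_dvd_iff)
    then show "c = c'" using c by (simp add: mod_pos_pos_trivial)
  qed
  ultimately have "card {0..<int l ^ K} \<le> card (fixker l M)"
    using fin by (intro card_inj_on_le) auto
  then show ?thesis by (simp add: nat_power_eq)
qed

lemma card_cyc2: "0 < l \<Longrightarrow> card (carrier (cyc2 l a b)) = l ^ (a + (a + b))"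
  by (simp add: carrier_integer_mod_group card_cartesian_product power_add nat_mult_distrib nat_power_eq)

lemma cyc2_pow: "x [^]\<^bsub>cyc2 l a b\<^esub> (n :: nat) = (int n * fst x mod int (l ^ a), int n * snd x mod int (l ^ (a + b)))"
proof -
  have "x [^]\<^bsub>G \<times>\<times> H\<^esub> n = (fst x [^]\<^bsub>G\<^esub> n, snd x [^]\<^bsub>H\<^esub> n)" for G H :: "int monoid"
    by (induction n) (simp_all add: mult_DirProd')
  then show ?thesis by simp
qed

text \<open>The first group is killed by \<open>l ^ (a + b)\<close>, while the second contains an
  element of order \<open>l ^ (a' + b')\<close>.\<close>

lemma cyc2_iso_exponent_le:
  assumes l: "prime l" and iso: "cyc2 l a b \<cong> cyc2 l a' b'"
  shows "a' + b' \<le> a + b"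
proof -
  have l1: "1 < l" using l prime_gt_1_nat by blast
  obtain h where "h \<in> iso (cyc2 l a b) (cyc2 l a' b')" using iso unfolding is_iso_def by blast
  then have h: "h \<in> hom (cyc2 l a b) (cyc2 l a' b')" "h ` carrier (cyc2 l a b) = carrier (cyc2 l a' b')"
    unfolding iso_iff by blast+
  let ?y = "(0, 1 mod int (l ^ (a' + b')))"
  have "?y \<in> carrier (cyc2 l a' b')" using l1 by (simp add: carrier_integer_mod_group)
  then obtain x where x: "x \<in> carrier (cyc2 l a b)" "h x = ?y" using h(2) by (metis imageE)
  have "x [^]\<^bsub>cyc2 l a b\<^esub> (l ^ (a + b)) = \<one>\<^bsub>cyc2 l a b\<^esub>"
    unfolding cyc2_pow by (simp add: power_add)
  then have "?y [^]\<^bsub>cyc2 l a' b'\<^esub> (l ^ (a + b)) = \<one>\<^bsub>cyc2 l a' b'\<^esub>"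
    using hom_nat_pow[OF h(1) x(1) group_cyc2 group_cyc2] hom_one[OF h(1) group_cyc2 group_cyc2] x(2) by metis
  then have "int (l ^ (a + b)) mod int (l ^ (a' + b')) = 0"
    unfolding cyc2_pow by (simp add: mod_mult_right_eq)
  then have "l ^ (a' + b') dvd l ^ (a + b)" by (simp only: dvd_eq_mod_eq_0[symmetric] int_dvd_int_iff)
  then show ?thesis using l1 by (simp add: dvd_power_iff_le)
qed

text \<open>The exponent of the group determines \<open>a + b\<close> and its order determines
  \<open>2 * a + b\<close>.\<close>

lemma cyc2_iso_unique:
  assumes l: "prime l" and iso: "cyc2 l a b \<cong> cyc2 l a' b'"
  shows "a = a' \<and> b = b'"
proof -
  have "cyc2 l a' b' \<cong> cyc2 l a b" using group.iso_sym[OF group_cyc2 iso] .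
  then have "a + b = a' + b'" using cyc2_iso_exponent_le[OF l] iso by (meson le_antisym)
  moreover have "l ^ (a + (a + b)) = l ^ (a' + (a' + b'))"
    using iso_same_card[OF iso] card_cyc2 l prime_gt_0_nat by metis
  then have "a + (a + b) = a' + (a' + b')" using l prime_power_inj by (metis)
  ultimately show ?thesis by linarith
qed

text \<open>For the forward direction, finiteness of the kernel forces some Smith type at sufficient
  precision, and uniqueness of the cyclic factors identifies it as \<open>(a, b)\<close>.\<close>

theorem fixgrp_iso_iff_smith_type:
  assumes l: "prime l" and M: "M \<in> Matl l"
  shows "fixgrp l M \<cong> cyc2 l a b \<longleftrightarrow> smith_type (int l) a b (M (Suc (a + b)))"
proof
  assume "smith_type (int l) a b (M (Suc (a + b)))"
  then show "fixgrp l M \<cong> cyc2 l a b"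
    using smith_type_imp_iso[OF l M] group.iso_sym[OF group_cyc2] by blast
next
  assume iso: "fixgrp l M \<cong> cyc2 l a b"
  have l1: "1 < l" using l prime_gt_1_nat by blast
  have "finite (carrier (cyc2 l a b))" using l1 by (simp add: carrier_integer_mod_group)
  then have fin: "finite (fixker l M)" using iso_finite[OF iso] by simp
  have card: "card (fixker l M) = l ^ (a + (a + b))" using iso_same_card[OF iso] card_cyc2 l1 by simp
  \<comment> \<open>One more than the exponent in the order of the kernel, so a primitive vector
    fixed modulo \<open>l ^ K\<close> would produce too many fixed points.\<close>
  define K where "K = Suc (a + (a + b))"
  have L: "prime (int l)" using l by simp
  show "smith_type (int l) a b (M (Suc (a + b)))"
  proof (rule smith_type_or_fixed_vector[OF L, of K "M K"])
    fix z assume "\<not> (int l dvd fst z \<and> int l dvd snd z)" "cong2 (int l ^ K) z (mapply (M K) z)"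
    then have "l ^ K \<le> l ^ (a + (a + b))" using card_fixker_ge[OF l M] fin card by metis
    then have False using l1 unfolding K_def by simp
    then show ?thesis ..
  next
    fix a' b' assume ab: "a' + b' < K" "smith_type (int l) a' b' (M K)"
    have "red (int l ^ Suc (a' + b')) (M (Suc (a' + b'))) = red (int l ^ Suc (a' + b')) (M K)"
      using Matl_red[OF M, of "Suc (a' + b')" K] Matl_red_self[OF M, of "Suc (a' + b')"] ab(1) by simp
    then have S: "smith_type (int l) a' b' (M (Suc (a' + b')))" using smith_type_cong ab(2) by blast
    then have "cyc2 l a' b' \<cong> cyc2 l a b" using smith_type_imp_iso[OF l M] iso iso_trans by blast
    then show ?thesis using cyc2_iso_unique[OF l] S by blast
  qed
qed

section \<open>Counting lifts\<close>

context quad_order begin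

lemma mlin_eq_0_above:
  assumes "k \<le> n" "red (int l ^ k) (mlin x y (W n)) = red (int l ^ k) (0, 0, 0, 0)"
  shows "int l ^ k dvd x \<and> int l ^ k dvd y"
proof -
  have "red (int l ^ k) (W k) = red (int l ^ k) (W n)"
    using Matl_red[OF W_Matl assms(1)] Matl_red_self[OF W_Matl, of k] by simp
  then have "red (int l ^ k) (mlin x y (W k)) = red (int l ^ k) (mlin x y (W n))"
    by (intro mlin_cong refl)
  then show ?thesis using assms(2) by (intro mlin_eq_0) (simp add: red_def)
qed

text \<open>Since \<open>W\<close> is not scalar modulo \<open>l\<close>, a power of
  \<open>l\<close> divides \<open>mlin u v\<close> exactly when it divides both coordinates. Content
  and primitivity thus pass from the matrix to the vector, and the determinant becomes the
  norm.\<close>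

lemma smith_type_mlin_iff:
  assumes "a \<le> k" "0 < k"
  shows "smith_type (int l) a b (mlin x y (W k)) \<longleftrightarrow>
    (\<exists>z \<in> prim_val (int l) (mtr (W k)) (mdet (W k)) b. x = 1 + int l ^ a * fst z \<and> y = int l ^ a * snd z)"
    (is "?S \<longleftrightarrow> ?R")
proof -
  let ?L = "int l"
  have l0: "0 < l" using prime_l prime_gt_0_nat by blast
  obtain w1 w2 w3 w4 where W: "W k = (w1, w2, w3, w4)" using prod_cases4 .
  have zero: "red ?L (mlin u v (W k)) = red ?L (0, 0, 0, 0) \<longleftrightarrow> ?L dvd u \<and> ?L dvd v" for u v
  proof
    assume "red ?L (mlin u v (W k)) = red ?L (0, 0, 0, 0)"
    then show "?L dvd u \<and> ?L dvd v" using mlin_eq_0_above[of 1 k u v] assms(2) by simp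
  qed (simp add: W mlin_def red_eq_iff)
  have nested: "mlin (1 + ?L ^ a * u) (?L ^ a * v) (W k) = mlin 1 (?L ^ a) (mlin u v (W k))" for u v
    by (simp add: W mlin_def algebra_simps)
  show ?thesis
  proof
    assume ?S
    then obtain A where A: "mlin x y (W k) = mlin 1 (?L ^ a) A" "red ?L A \<noteq> red ?L (0, 0, 0, 0)"
      "exact_val ?L b (mdet A)" unfolding smith_type_def by blast
    obtain p q r s where A': "A = (p, q, r, s)" using prod_cases4 .
    have "red (?L ^ a) (mlin (x - 1) y (W k)) = red (?L ^ a) (0, 0, 0, 0)"
      using A(1) unfolding W A' mlin_def prod.case red_eq_iff prod.inject by (simp add: algebra_simps)
    then have "?L ^ a dvd x - 1 \<and> ?L ^ a dvd y" by (rule mlin_eq_0_above[OF assms(1)])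
    then obtain u v where uv: "x = 1 + ?L ^ a * u" "y = ?L ^ a * v"
      by (metis dvdE add.commute diff_add_cancel)
    have "A = mlin u v (W k)"
      using A(1) l0 unfolding uv nested unfolding A' by (auto simp: W mlin_def)
    then have "(u, v) \<in> prim_val ?L (mtr (W k)) (mdet (W k)) b"
      using A(2,3) zero by (simp add: prim_val_def mdet_mlin)
    then show ?R using uv by force
  next
    assume ?R
    then obtain u v where "(u, v) \<in> prim_val ?L (mtr (W k)) (mdet (W k)) b"
      "x = 1 + ?L ^ a * u" "y = ?L ^ a * v" by auto
    then show ?S unfolding smith_type_def
      using nested[of u v] zero[of u v] by (intro exI[of _ "mlin u v (W k)"]) (simp add: prim_val_def mdet_mlin)
  qed
qed

text \<open>The full \<open>l\<close>-adic matrix of \<open>1 + l ^ a z\<close> for an integer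
  vector \<open>z\<close>, which provides an explicit element lifting a class given only modulo a
  power of \<open>l\<close>.\<close>

definition elt :: "nat \<Rightarrow> int \<times> int \<Rightarrow> nat \<Rightarrow> mat2" where
  "elt a z = (\<lambda>k. red (int l ^ k) (mlin (1 + int l ^ a * fst z) (int l ^ a * snd z) (W k)))"

lemma elt_eq_iff:
  assumes "a \<le> k"
  shows "elt a z k = elt a z' k \<longleftrightarrow> cong2 (int l ^ (k - a)) z z'"
proof -
  let ?L = "int l"
  have l0: "0 < l" using prime_l prime_gt_0_nat by blast
  have split: "?L ^ k = ?L ^ a * ?L ^ (k - a)" using assms by (simp flip: power_add)
  obtain w1 w2 w3 w4 where W: "W k = (w1, w2, w3, w4)" using prod_cases4 .
  have "elt a z k = elt a z' k \<longleftrightarrow>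
    red (?L ^ k) (mlin (?L ^ a * (fst z' - fst z)) (?L ^ a * (snd z' - snd z)) (W k)) = red (?L ^ k) (0, 0, 0, 0)"
    unfolding elt_def W mlin_def prod.case red_eq_iff by (simp add: algebra_simps dvd_diff_commute[of "?L ^ k"]) 
  also have "\<dots> \<longleftrightarrow> ?L ^ k dvd ?L ^ a * (fst z' - fst z) \<and> ?L ^ k dvd ?L ^ a * (snd z' - snd z)"
  proof
    assume "?L ^ k dvd ?L ^ a * (fst z' - fst z) \<and> ?L ^ k dvd ?L ^ a * (snd z' - snd z)"
    then show "red (?L ^ k) (mlin (?L ^ a * (fst z' - fst z)) (?L ^ a * (snd z' - snd z)) (W k)) = red (?L ^ k) (0, 0, 0, 0)"
      unfolding W mlin_def prod.case red_eq_iff by (simp add: dvd_mult2)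
  qed (rule mlin_eq_0_above[OF le_refl])
  also have "\<dots> \<longleftrightarrow> cong2 (?L ^ (k - a)) z z'"
    unfolding split cong2_def using l0 by simp
  finally show ?thesis .
qed

lemma elt_below:
  assumes "k \<le> a"
  shows "elt a z k = lI l k"
proof -
  have "int l ^ k dvd int l ^ a" using assms by (rule le_imp_power_dvd)
  then show ?thesis unfolding elt_def lI_eq_mlin
    by (intro mlin_cong refl) (simp_all add: mod_eq_dvd_iff)
qed

lemma smith_type_elt:
  assumes "z \<in> prim_val (int l) (mtr (W k)) (mdet (W k)) b" "a + b < k"
  shows "smith_type (int l) a b (elt a z (Suc (a + b)))"
proof -
  let ?s = "Suc (a + b)" and ?L = "int l"
  let ?x = "1 + ?L ^ a * fst z" and ?y = "?L ^ a * snd z"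
  have "smith_type ?L a b (mlin ?x ?y (W k))"
    by (subst smith_type_mlin_iff) (use assms in auto)
  moreover have "red (?L ^ ?s) (elt a z ?s) = red (?L ^ ?s) (mlin ?x ?y (W k))"
    unfolding elt_def red_idem
    using assms(2) Matl_red[OF W_Matl, of ?s k] Matl_red_self[OF W_Matl, of ?s]
    by (intro mlin_cong refl) simp
  ultimately show ?thesis using smith_type_cong by blast
qed

text \<open>The vector is read off from the coordinates of \<open>M\<close> at precision
  \<open>K\<close>, hence the agreement with \<open>elt a z\<close> up to \<open>K\<close>.\<close>

lemma smith_type_imp_elt:
  assumes M: "M \<in> units" and S: "smith_type (int l) a b (M (Suc (a + b)))" and K: "a + b < K"
  obtains z where "z \<in> prim_val (int l) (mtr (W K)) (mdet (W K)) b" "\<And>k. k \<le> K \<Longrightarrow> M k = elt a z k"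
proof -
  let ?s = "Suc (a + b)" and ?L = "int l"
  obtain x y where xy: "coherent l x" "coherent l y" "M = (\<lambda>n. red (?L ^ n) (mlin (x n) (y n) (W n)))"
    using unitsE[OF M] .
  have "red (?L ^ ?s) (mlin (x K) (y K) (W K)) = red (?L ^ ?s) (M K)"
    unfolding xy(3) using K by (simp add: red_red le_imp_power_dvd del: power_Suc)
  also have "\<dots> = red (?L ^ ?s) (M ?s)"
    using Matl_red[OF units_Matl[OF M], of ?s K] Matl_red_self[OF units_Matl[OF M], of ?s] K by simp
  finally have "smith_type ?L a b (mlin (x K) (y K) (W K))" using smith_type_cong S by blast
  then obtain z where z: "z \<in> prim_val ?L (mtr (W K)) (mdet (W K)) b"
    "x K = 1 + ?L ^ a * fst z" "y K = ?L ^ a * snd z"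
    using smith_type_mlin_iff[of a K b "x K" "y K"] K by auto
  have "M k = elt a z k" if "k \<le> K" for k
    unfolding xy(3) elt_def z(2,3)[symmetric]
    using xy(1,2) that unfolding coherent_def by (intro mlin_cong refl) metis+
  then show ?thesis using that z(1) by blast
qed

section \<open>Fibres of the reduction in coordinates\<close>

lemma Mab_iff:
  assumes "G \<subseteq> units"
  shows "M \<in> Mab l G a b \<longleftrightarrow> M \<in> G \<and> smith_type (int l) a b (M (Suc (a + b)))"
  unfolding Mab_def using fixgrp_iso_iff_smith_type[OF prime_l] units_Matl assms by blast

text \<open>Agreement with \<open>M\<close> modulo \<open>l ^ n\<close> gives a unit determinant
  because \<open>n \<ge> 1\<close>, and membership in \<open>G\<close> because \<open>n\<close> is
  at least the level. The kernel type comes from \<open>z\<close>.\<close>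

lemma elt_Mab:
  assumes G: "open_subgroup l G units" and n: "level l units G \<le> n"
    and M: "M \<in> G" "M n = elt a z n"
    and z: "z \<in> prim_val (int l) (mtr (W K)) (mdet (W K)) b" "a + b < K"
  shows "elt a z \<in> Mab l G a b"
proof -
  have GU: "G \<subseteq> units" using G unfolding open_subgroup_def by auto
  have n1: "1 \<le> n" using level_attained(1)[OF G] n by linarith
  have "coherent_mat l (\<lambda>k. mlin (1 + int l ^ a * fst z) (int l ^ a * snd z) (W k))"
    by (intro coherent_mlin coherent_const W_coherent)
  then have elt: "elt a z \<in> Matl l" unfolding elt_def by (rule coherent_red_Matl)
  have MM: "M \<in> Matl l" "M \<in> GL2 l" using M(1) GU units_GL2 units_Matl by auto
  have "M 1 = elt a z 1"
    using Matl_red[OF MM(1) n1] Matl_red[OF elt n1] M(2) by simp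
  then have "\<not> int l dvd mdet (elt a z 1)" using MM(2) by (simp add: GL2_def)
  then have "elt a z \<in> units" unfolding elt_def
    by (intro unitsI coherent_const) (use dvd_mdet_cong[OF red_idem, of "int l"] in simp)
  then have "elt a z \<in> G" using congruent_in_subgroup[OF G n M(1)] M(2) by blast
  then show ?thesis using Mab_iff[OF GU] smith_type_elt[OF z] by blast
qed

text \<open>\<open>elt a w (Suc n)\<close> depends exactly on \<open>w\<close> modulo
  \<open>l ^ (n - a + 1)\<close>, so lifts of the matrix correspond to lifts of the vector. Taking
  \<open>K\<close> above both \<open>n\<close> and \<open>a + b\<close> makes the trace and
  determinant of \<open>W K\<close> precise enough to define the form.\<close>

lemma card_Mab_lifts:
  assumes G: "open_subgroup l G units" and n: "level l units G \<le> n" "a < n"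
    and M: "M \<in> Mab l G a b" and K: "a + b < K" "n < K"
    and z: "M n = elt a z n"
  shows "card {N \<in> Mab_n l G a b (Suc n). red (int l ^ n) N = M n} =
    card (lifts (int l) (mtr (W K)) (mdet (W K)) b (n - a) z)"
proof -
  let ?L = "int l"
  let ?V = "{z' \<in> prim_val ?L (mtr (W K)) (mdet (W K)) b. cong2 (?L ^ (n - a)) z z'}"
  let ?k = "?L ^ Suc (n - a)"
  have GU: "G \<subseteq> units" using G unfolding open_subgroup_def by auto
  have elt_Suc: "elt a w (Suc n) = elt a w' (Suc n) \<longleftrightarrow> mod2 ?k w = mod2 ?k w'" for w w'
    using elt_eq_iff[of a "Suc n" w w'] n(2) by (simp add: mod2_eq_iff Suc_diff_le) (metis cong2_sym)
  have elt_n: "elt a w n = elt a w' n \<longleftrightarrow> cong2 (?L ^ (n - a)) w w'" for w w'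
    using elt_eq_iff n(2) by simp
  have mod2_idem: "mod2 ?k (mod2 ?k w) = mod2 ?k w" for w by (simp add: mod2_def)
  have "{N \<in> Mab_n l G a b (Suc n). red (?L ^ n) N = M n} = (\<lambda>w. elt a w (Suc n)) ` ?V"
  proof (rule subset_antisym; rule subsetI)
    fix N assume "N \<in> {N \<in> Mab_n l G a b (Suc n). red (?L ^ n) N = M n}"
    then obtain M' where M': "M' \<in> Mab l G a b" "N = M' (Suc n)" "red (?L ^ n) (M' (Suc n)) = M n"
      unfolding Mab_n_def lvl_img_def by auto
    then have "M' \<in> units" "smith_type ?L a b (M' (Suc (a + b)))" using Mab_iff[OF GU] GU by auto
    then obtain w where w: "w \<in> prim_val ?L (mtr (W K)) (mdet (W K)) b" "\<And>k. k \<le> K \<Longrightarrow> M' k = elt a w k"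
      using smith_type_imp_elt K(1) by metis
    have "M' n = M n" using M'(3) Matl_red[of M' l n "Suc n"] units_Matl[OF \<open>M' \<in> units\<close>] by simp
    then have "cong2 (?L ^ (n - a)) z w" using w(2)[of n] z elt_n[of z w] K(2) by simp
    then show "N \<in> (\<lambda>w. elt a w (Suc n)) ` ?V" using w M'(2) K(2) by auto
  next
    fix N assume "N \<in> (\<lambda>w. elt a w (Suc n)) ` ?V"
    then obtain w where w: "w \<in> prim_val ?L (mtr (W K)) (mdet (W K)) b" "cong2 (?L ^ (n - a)) z w"
      "N = elt a w (Suc n)" by blast
    have Mw: "M n = elt a w n" using z elt_n w(2) by simp
    have "M \<in> G" using M unfolding Mab_def by blast
    then have E: "elt a w \<in> Mab l G a b" using elt_Mab[OF G n(1)] Mw w(1) K(1) by blast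
    then have "elt a w \<in> Matl l" using Mab_iff[OF GU] GU units_Matl by auto
    then have "red (?L ^ n) N = M n" unfolding Mw w(3) by (simp add: Matl_red)
    then show "N \<in> {N \<in> Mab_n l G a b (Suc n). red (?L ^ n) N = M n}"
      using E w(3) unfolding Mab_n_def lvl_img_def by blast
  qed
  \<comment> \<open>Replacing vectors by their residues makes the map to matrices injective.\<close>
  also have "\<dots> = (\<lambda>w. elt a w (Suc n)) ` mod2 ?k ` ?V"
    unfolding image_image by (intro image_cong refl iffD2[OF elt_Suc] mod2_idem[symmetric])
  finally have "card {N \<in> Mab_n l G a b (Suc n). red (?L ^ n) N = M n} =
     card ((\<lambda>w. elt a w (Suc n)) ` mod2 ?k ` ?V)" by simp
  also have "\<dots> = card (mod2 ?k ` ?V)"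
  proof (rule card_image, rule inj_onI)
    fix u v assume "u \<in> mod2 ?k ` ?V" "v \<in> mod2 ?k ` ?V" "elt a u (Suc n) = elt a v (Suc n)"
    moreover from this have "mod2 ?k u = mod2 ?k v" unfolding elt_Suc by blast
    ultimately show "u = v" by (elim imageE) (simp only: mod2_idem)
  qed
  finally show ?thesis unfolding lifts_def .
qed

theorem card_Mab_lifts_eq:
  assumes G: "open_subgroup l G units" and n: "level l units G \<le> n"
    and M: "M1 \<in> Mab_n l G a b n" "M2 \<in> Mab_n l G a b n"
  shows "card {N \<in> Mab_n l G a b (Suc n). red (int l ^ n) N = M1}
       = card {N \<in> Mab_n l G a b (Suc n). red (int l ^ n) N = M2}"
proof -
  have GU: "G \<subseteq> units" using G unfolding open_subgroup_def by auto
  \<comment> \<open>One precision for both matrices, so that both counts refer to the same integral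
    form.\<close>
  define K where "K = Suc (a + b + n)"
  have K: "a + b < K" "n < K" unfolding K_def by auto
  let ?V = "prim_val (int l) (mtr (W K)) (mdet (W K)) b"
  have ex: "\<exists>M\<in>Mab l G a b. \<exists>z\<in>?V. N = M n \<and> M n = elt a z n" if N: "N \<in> Mab_n l G a b n" for N
  proof -
    obtain M where M: "M \<in> Mab l G a b" "N = M n" using N unfolding Mab_n_def lvl_img_def by blast
    then have "M \<in> units" "smith_type (int l) a b (M (Suc (a + b)))" using Mab_iff[OF GU] GU by auto
    then obtain z where "z \<in> ?V" "\<And>k. k \<le> K \<Longrightarrow> M k = elt a z k"
      using smith_type_imp_elt K(1) by metis
    moreover have "n \<le> K" using K(2) by simp
    ultimately show ?thesis using M by blast
  qed
  obtain X1 z1 where 1: "X1 \<in> Mab l G a b" "z1 \<in> ?V" "M1 = X1 n" "X1 n = elt a z1 n" using ex[OF M(1)] by blast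
  obtain X2 z2 where 2: "X2 \<in> Mab l G a b" "z2 \<in> ?V" "M2 = X2 n" "X2 n = elt a z2 n" using ex[OF M(2)] by blast
  show ?thesis
  proof (cases "n \<le> a")
    case True
    then have "M1 = M2" using 1 2 elt_below by simp
    then show ?thesis by simp
  next
    case False
    then show ?thesis unfolding 1(3) 2(3)
      using card_Mab_lifts[OF G n _ 1(1) K 1(4)] card_Mab_lifts[OF G n _ 2(1) K 2(4)]
        card_lifts_eq[OF _ _ 1(2) 2(2)] prime_l by simp
  qed
qed

end

theorem theorem14:
  fixes l :: nat and t d :: "nat \<Rightarrow> int" and P :: "nat \<Rightarrow> mat2"
    and G :: "(nat \<Rightarrow> mat2) set" and a b n :: nat and M1 M2 :: mat2
  assumes "prime l"
    and "quadratic_ring_data l t d"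
    and "P \<in> GL2 l"
    and "ramified l t d"
    and "open_subgroup l G (cartan l t d P)"
    and "n \<ge> level l (cartan l t d P) G"
    and "M1 \<in> Mab_n l G a b n" and "M2 \<in> Mab_n l G a b n"
  shows "card {N \<in> Mab_n l G a b (Suc n). red (int l ^ n) N = M1}
       = card {N \<in> Mab_n l G a b (Suc n). red (int l ^ n) N = M2}"
proof -
  obtain W where W: "quad_order l W" "cartan l t d P = quad_order.units l W"
    using cartan_eq_units assms(1-3) unfolding quadratic_ring_data_def by metis
  show ?thesis using quad_order.card_Mab_lifts_eq[OF W(1)] assms(5-8) unfolding W(2) by blast
qed

end
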